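(* Every regular quantum circuit $C\in\mathbf{QC}$ is equivalent to a normal form; that is, there is a circuit $N$ in normal form with $C\equiv N$.
   Context: A set $QV$ of quantum variables is given; each quantum variable $q$ has a Hilbert space $\mathcal H_q$ as its state space. A register $\bar q=q_1,\dots,q_n$ is a sequence of distinct variables (also identified with the set $\{q_1,\dots,q_n\}$), with state space $\mathcal H_{\bar q}=\bigotimes_i\mathcal H_{q_i}$. A set $\mathcal U$ of unitary constants is given (containing the $2\times 2$ identity), each with a type $\mathcal H_1\otimes\cdots\otimes\mathcal H_n$; $U[\bar q]$ is a basic gate when the type of $U\in\mathcal U$ matches that of $\bar q$. Circuits $C\in\mathbf{QC}$ are given by $C::=\mathbf{skip}\mid U[\bar q]\mid C_1;C_2\mid \mathbf{qif}\,[\bar q](\square_{i=1}^d|\psi_i\rangle\to C_i)\,\mathbf{fiq}$, where in the quantum if-statement $\{|\psi_i\rangle\}_{i=1}^d$ is an orthonormal basis of $\mathcal H_{\bar q}$ (the guard basis; $\bar q$ is the guard register) and $\bar q\cap\bigcup_i qv(C_i)=\emptyset$. Here $qv(C)$ is the set of variables of $C$: $qv(\mathbf{skip})=\emptyset$, $qv(U[\bar q])=\bar q$, $qv(C_1;C_2)=qv(C_1)\cup qv(C_2)$, and $qv$ of the quantum if-statement is $\bar q\cup\bigcup_i qv(C_i)$. Semantics: $[\![C]\!]$ is the unitary on $\mathcal H_{qv(C)}$ with $[\![\mathbf{skip}]\!]=I$, $[\![U[\bar q]]\!]=U_{\bar q}$ ($U$ acting on $\bar q$), $[\![C_1;C_2]\!]=[\![C_2]\!]\,[\![C_1]\!]$,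 and $[\![\mathbf{qif}\,[\bar q](\square_i|\psi_i\rangle\to C_i)\,\mathbf{fiq}]\!]=\sum_i|\psi_i\rangle_{\bar q}\langle\psi_i|\otimes[\![C_i]\!]$, where operators are extended by the identity to all variables of the whole circuit. Equivalence: $C_1\equiv C_2$ iff $[\![C_1]\!]\otimes I_{qv(C_2)\setminus qv(C_1)}=[\![C_2]\!]\otimes I_{qv(C_1)\setminus qv(C_2)}$. For each variable $q$ a fixed orthonormal basis of $\mathcal H_q$ is chosen as its standard basis; the standard basis $\{|i\rangle\}$ of a register consists of the tensor products of standard basis states of its variables. A flat quantum if-statement is a circuit without nested quantum if-statements, i.e. of the form $\mathbf{qif}\,[\bar q](\square_i|i\rangle\to G_i)\,\mathbf{fiq}$ where $\{|i\rangle\}$ is the standard basis of $\bar q$ and each $G_i$ is a sequential composition of basic gates or $\mathbf{skip}$. A normal form is a sequential composition $C_1;\dots;C_n$ with every $C_i$ a flat quantum if-statement. A circuit $C$ is regular if for every guard basis $\{|\psi_i\rangle\}$ of a quantum if-statement in $C$, with guard register $\bar q$ and standard basis $\{|i\rangle\}$ of $\bar q$, both unitary transformations $\sum_i|\psi_i\rangle\langle i|$ and $\sum_i|i\rangle\langle\psi_i|$ can be implemented by a sequence of basic gates or $\mathbf{skip}$. *)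

theory Defs
  imports "HOL-Analysis.Infinite_Sum" "HOL-Library.FuncSet"
begin

text \<open>
  Since every state space comes with a chosen orthonormal basis, Hilbert spaces are written in
  coordinates: a Hilbert space whose standard basis is labelled by the set \<open>X\<close> is
  \<open>\<ell>\<^sup>2(X)\<close>, and operators on it are maps on \<open>\<ell>\<^sup>2(X)\<close> (of arbitrary, possibly infinite, dimension).
  Vectors vanish outside \<open>X\<close>, so that equality of vectors is equality of functions.
\<close>

type_synonym 'x vect = "'x \<Rightarrow> complex"
type_synonym 'x oper = "'x vect \<Rightarrow> 'x vect"

definition l2 :: "'x set \<Rightarrow> 'x vect set" where
  "l2 X = {v. (\<forall>x. x \<notin> X \<longrightarrow> v x = 0) \<and> (\<lambda>x. (cmod (v x))\<^sup>2) summable_on X}"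

definition l2_inner :: "'x set \<Rightarrow> 'x vect \<Rightarrow> 'x vect \<Rightarrow> complex" where
  "l2_inner X u v = (\<Sum>\<^sub>\<infinity>x\<in>X. cnj (u x) * v x)"

definition ket :: "'x \<Rightarrow> 'x vect" where
  "ket x = (\<lambda>y. if y = x then 1 else 0)"

text \<open>The operator \<open>|\<phi>\<rangle>\<langle>\<psi>|\<close>.\<close>

definition ketbra :: "'x set \<Rightarrow> 'x vect \<Rightarrow> 'x vect \<Rightarrow> 'x oper" where
  "ketbra X \<phi> \<psi> = (\<lambda>v x. \<phi> x * l2_inner X \<psi> v)"

definition unitary_on :: "'x set \<Rightarrow> 'x oper \<Rightarrow> bool" where
  "unitary_on X U \<longleftrightarrow>
     U ` l2 X = l2 X \<and>
     (\<forall>u\<in>l2 X. \<forall>v\<in>l2 X. U (\<lambda>x. u x + v x) = (\<lambda>x. U u x + U v x)) \<and>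
     (\<forall>c. \<forall>v\<in>l2 X. U (\<lambda>x. c * v x) = (\<lambda>x. c * U v x)) \<and>
     (\<forall>u\<in>l2 X. \<forall>v\<in>l2 X. l2_inner X (U u) (U v) = l2_inner X u v)"

definition orthonormal_basis :: "'x set \<Rightarrow> 'x vect list \<Rightarrow> bool" where
  "orthonormal_basis X bs \<longleftrightarrow>
     set bs \<subseteq> l2 X \<and>
     (\<forall>i<length bs. \<forall>j<length bs. l2_inner X (bs ! i) (bs ! j) = (if i = j then 1 else 0)) \<and>
     (\<forall>v\<in>l2 X. \<exists>c. v = (\<lambda>x. \<Sum>i<length bs. c i * (bs ! i) x))"

text \<open>
  \<open>labels Q q\<close> labels the standard basis of the state space of the variable \<open>q\<close>, so this set also
  serves as the type of \<open>q\<close>.  The type of a unitary constant is the list of the types of its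
  tensor factors, and the constant acts on vectors indexed by tuples of labels.
\<close>

record ('q, 'b, 'u) qsig =
  qvars :: "'q set"
  labels :: "'q \<Rightarrow> 'b set"
  consts_of :: "'u set"
  ctype :: "'u \<Rightarrow> 'b set list"
  cop :: "'u \<Rightarrow> 'b list oper"

text \<open>State spaces are nonzero; the last conjunct says that the 2 by 2 identity is a constant.\<close>

definition quantum_signature :: "('q, 'b, 'u) qsig \<Rightarrow> bool" where
  "quantum_signature Q \<longleftrightarrow>
     (\<forall>q\<in>qvars Q. labels Q q \<noteq> {}) \<and>
     (\<forall>u\<in>consts_of Q. unitary_on (listset (ctype Q u)) (cop Q u)) \<and>
     (\<exists>u\<in>consts_of Q. \<exists>D. card D = 2 \<and> ctype Q u = [D] \<and>
        (\<forall>v\<in>l2 (listset [D]). cop Q u v = v))"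

text \<open>
  The standard basis of a register with variable set \<open>S\<close>: the tensor product of the standard basis
  states labelled \<open>\<sigma> q\<close> (\<open>q \<in> S\<close>) has label \<open>\<sigma>\<close>.  The state space of the register is
  \<open>l2 (assigns Q S)\<close>; for \<open>S = {}\<close> it is one-dimensional.
\<close>

definition assigns :: "('q, 'b, 'u) qsig \<Rightarrow> 'q set \<Rightarrow> ('q \<Rightarrow> 'b) set" where
  "assigns Q S = Pi\<^sub>E S (labels Q)"

text \<open>
  For an operator \<open>A\<close> on the variables \<open>S \<subseteq> W\<close>, \<open>extend Q S W A\<close> is \<open>A \<otimes> I\<close> on the variables \<open>W\<close>.
  Writing \<open>v = (\<Sum>\<rho>. v\<^sub>\<rho> \<otimes> |\<rho>\<rangle>)\<close> with \<open>\<rho>\<close> ranging over the labels of \<open>W - S\<close>, we have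
  \<open>(A \<otimes> I) v = (\<Sum>\<rho>. A v\<^sub>\<rho> \<otimes> |\<rho>\<rangle>)\<close>; below, \<open>v\<^sub>\<rho>\<close> is the inner abstraction for \<open>\<rho> = \<sigma>\<close> on \<open>W - S\<close>.
\<close>

definition extend ::
  "('q, 'b, 'u) qsig \<Rightarrow> 'q set \<Rightarrow> 'q set \<Rightarrow> ('q \<Rightarrow> 'b) oper \<Rightarrow> ('q \<Rightarrow> 'b) oper" where
  "extend Q S W A = (\<lambda>v \<sigma>.
     if \<sigma> \<in> assigns Q W
     then A (\<lambda>\<tau>. if \<tau> \<in> assigns Q S then v (\<lambda>q. if q \<in> S then \<tau> q else \<sigma> q) else 0) (restrict \<sigma> S)
     else 0)"

text \<open>
  The branches of \<open>QIf\<close> are the pairs of a guard state \<open>|\<psi>\<^sub>i\<rangle>\<close> and the corresponding circuit.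
\<close>

datatype ('q, 'b, 'u) circ =
    Skip
  | Gate 'u "'q list"
  | Seq "('q, 'b, 'u) circ" "('q, 'b, 'u) circ"
  | QIf "'q list" "(('q \<Rightarrow> 'b) vect \<times> ('q, 'b, 'u) circ) list"

fun qv :: "('q, 'b, 'u) circ \<Rightarrow> 'q set" where
  "qv Skip = {}"
| "qv (Gate u qs) = set qs"
| "qv (Seq C D) = qv C \<union> qv D"
| "qv (QIf qs bs) = set qs \<union> (\<Union>(\<psi>, C)\<in>set bs. qv C)"

text \<open>Registers may be empty.\<close>

definition is_register :: "('q, 'b, 'u) qsig \<Rightarrow> 'q list \<Rightarrow> bool" where
  "is_register Q qs \<longleftrightarrow> distinct qs \<and> set qs \<subseteq> qvars Q"

fun wf_circ :: "('q, 'b, 'u) qsig \<Rightarrow> ('q, 'b, 'u) circ \<Rightarrow> bool" where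
  "wf_circ Q Skip \<longleftrightarrow> True"
| "wf_circ Q (Gate u qs) \<longleftrightarrow>
     u \<in> consts_of Q \<and> is_register Q qs \<and> map (labels Q) qs = ctype Q u"
| "wf_circ Q (Seq C D) \<longleftrightarrow> wf_circ Q C \<and> wf_circ Q D"
| "wf_circ Q (QIf qs bs) \<longleftrightarrow>
     is_register Q qs \<and>
     orthonormal_basis (assigns Q (set qs)) (map fst bs) \<and>
     (\<forall>(\<psi>, C)\<in>set bs. wf_circ Q C \<and> set qs \<inter> qv C = {})"

definition QC :: "('q, 'b, 'u) qsig \<Rightarrow> ('q, 'b, 'u) circ set" where
  "QC Q = {C. wf_circ Q C}"

text \<open>\<open>U\<close> acting on the register \<open>qs\<close>: tuples \<open>xs\<close> of labels are matched with assignments to \<open>qs\<close>.\<close>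

definition gate_op ::
  "('q, 'b, 'u) qsig \<Rightarrow> 'u \<Rightarrow> 'q list \<Rightarrow> ('q \<Rightarrow> 'b) oper" where
  "gate_op Q u qs = (\<lambda>v \<sigma>.
     if \<sigma> \<in> assigns Q (set qs)
     then cop Q u
            (\<lambda>xs. if xs \<in> listset (ctype Q u)
                  then v (\<lambda>q. case map_of (zip qs xs) q of Some b \<Rightarrow> b | None \<Rightarrow> undefined)
                  else 0)
            (map \<sigma> qs)
     else 0)"

text \<open>
  In the last clause \<open>|\<psi>\<rangle>\<langle>\<psi>| \<otimes> \<lbrakk>C\<rbrakk>\<close> is the composition of the extensions of its two factors, which act
  on disjoint sets of variables.
\<close>

fun sem :: "('q, 'b, 'u) qsig \<Rightarrow> ('q, 'b, 'u) circ \<Rightarrow> ('q \<Rightarrow> 'b) oper" where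
  "sem Q Skip = (\<lambda>v. v)"
| "sem Q (Gate u qs) = gate_op Q u qs"
| "sem Q (Seq C D) =
     extend Q (qv D) (qv C \<union> qv D) (sem Q D) \<circ> extend Q (qv C) (qv C \<union> qv D) (sem Q C)"
| "sem Q (QIf qs bs) =
     (let W = set qs \<union> (\<Union>(\<psi>, C)\<in>set bs. qv C) in
      (\<lambda>v \<sigma>. \<Sum>(\<psi>, C)\<leftarrow>bs.
         extend Q (set qs) W (ketbra (assigns Q (set qs)) \<psi> \<psi>)
           (extend Q (qv C) W (sem Q C) v) \<sigma>))"

definition equivalent ::
  "('q, 'b, 'u) qsig \<Rightarrow> ('q, 'b, 'u) circ \<Rightarrow> ('q, 'b, 'u) circ \<Rightarrow> bool" where
  "equivalent Q C D \<longleftrightarrow>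
     (\<forall>v\<in>l2 (assigns Q (qv C \<union> qv D)).
        extend Q (qv C) (qv C \<union> qv D) (sem Q C) v = extend Q (qv D) (qv C \<union> qv D) (sem Q D) v)"

fun gate_seq :: "('q, 'b, 'u) circ \<Rightarrow> bool" where
  "gate_seq Skip \<longleftrightarrow> True"
| "gate_seq (Gate u qs) \<longleftrightarrow> True"
| "gate_seq (Seq C D) \<longleftrightarrow> gate_seq C \<and> gate_seq D"
| "gate_seq (QIf qs bs) \<longleftrightarrow> False"

text \<open>An enumeration of the labels of the standard basis of the register \<open>qs\<close>.\<close>

definition std_enum :: "('q, 'b, 'u) qsig \<Rightarrow> 'q list \<Rightarrow> ('q \<Rightarrow> 'b) list \<Rightarrow> bool" where
  "std_enum Q qs es \<longleftrightarrow> distinct es \<and> set es = assigns Q (set qs)"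

fun flat_qif :: "('q, 'b, 'u) qsig \<Rightarrow> ('q, 'b, 'u) circ \<Rightarrow> bool" where
  "flat_qif Q (QIf qs bs) \<longleftrightarrow>
     (\<exists>es. std_enum Q qs es \<and> map fst bs = map ket es) \<and> (\<forall>(\<psi>, G)\<in>set bs. gate_seq G)"
| "flat_qif Q _ \<longleftrightarrow> False"

fun normal_form :: "('q, 'b, 'u) qsig \<Rightarrow> ('q, 'b, 'u) circ \<Rightarrow> bool" where
  "normal_form Q (Seq C D) \<longleftrightarrow> normal_form Q C \<and> normal_form Q D"
| "normal_form Q C \<longleftrightarrow> flat_qif Q C"

text \<open>
  A transformation of the state space of a register is implemented on that register, i.e. by gates
  on variables of the register.
\<close>

definition implementable ::
  "('q, 'b, 'u) qsig \<Rightarrow> 'q list \<Rightarrow> ('q \<Rightarrow> 'b) oper \<Rightarrow> bool" where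
  "implementable Q qs V \<longleftrightarrow>
     (\<exists>G\<in>QC Q. gate_seq G \<and> qv G \<subseteq> set qs \<and>
        (\<forall>v\<in>l2 (assigns Q (set qs)). extend Q (qv G) (set qs) (sem Q G) v = V v))"

text \<open>
  The index \<open>i\<close> of \<open>|i\<rangle>\<close> refers to some enumeration \<open>es\<close> of the standard basis, the same one for both
  transformations \<open>\<Sum>\<^sub>i |\<psi>\<^sub>i\<rangle>\<langle>i|\<close> and \<open>\<Sum>\<^sub>i |i\<rangle>\<langle>\<psi>\<^sub>i|\<close>.
\<close>

definition regular_guard ::
  "('q, 'b, 'u) qsig \<Rightarrow> 'q list \<Rightarrow> ('q \<Rightarrow> 'b) vect list \<Rightarrow> bool" where
  "regular_guard Q qs \<psi>s \<longleftrightarrow>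
     (\<exists>es. std_enum Q qs es \<and>
        implementable Q qs
          (\<lambda>v \<sigma>. \<Sum>(\<psi>, e)\<leftarrow>zip \<psi>s es. ketbra (assigns Q (set qs)) \<psi> (ket e) v \<sigma>) \<and>
        implementable Q qs
          (\<lambda>v \<sigma>. \<Sum>(\<psi>, e)\<leftarrow>zip \<psi>s es. ketbra (assigns Q (set qs)) (ket e) \<psi> v \<sigma>))"

fun regular :: "('q, 'b, 'u) qsig \<Rightarrow> ('q, 'b, 'u) circ \<Rightarrow> bool" where
  "regular Q Skip \<longleftrightarrow> True"
| "regular Q (Gate u qs) \<longleftrightarrow> True"
| "regular Q (Seq C D) \<longleftrightarrow> regular Q C \<and> regular Q D"
| "regular Q (QIf qs bs) \<longleftrightarrow>
     regular_guard Q qs (map fst bs) \<and> (\<forall>(\<psi>, C)\<in>set bs. regular Q C)"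

text \<open>
  With nonempty guard registers only, a normal form of a circuit may need a variable that does not
  occur in the circuit (consider a basic gate on all available variables); with empty ones it need
  not.  \<open>[] \<notin> guards N\<close> says that \<open>N\<close> does without empty guard registers.
\<close>

fun guards :: "('q, 'b, 'u) circ \<Rightarrow> 'q list set" where
  "guards Skip = {}"
| "guards (Gate u qs) = {}"
| "guards (Seq C D) = guards C \<union> guards D"
| "guards (QIf qs bs) = insert qs (\<Union>(\<psi>, C)\<in>set bs. guards C)"

end

theory Submission
  imports Defs "HOL-Analysis.Convex"
begin

text \<open>
  The normal form is built by induction on the circuit.  A basic gate is wrapped into a quantum
  if-statement with equal branches, guarded by a fresh variable or by the empty register.  In a
  quantum if-statement over \<open>|\<psi>\<^sub>i\<rangle>\<close> the guard basis is first rotated to the standard basis by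
  \<open>\<Sum>\<^sub>i |i\<rangle>\<langle>\<psi>\<^sub>i|\<close> and rotated back at the end.  In between, an if-statement over the standard
  basis whose branches are already normal forms is executed branch by branch: each flat
  if-statement of the branch \<open>i\<close>, conditioned on \<open>|i\<rangle>\<close>, is again flat over the joined guard register.
\<close>

section \<open>Square-summable vectors and linear operators\<close>

text \<open>Running the branches one after another is sound because a branch never touches its guard
  register: at a label \<open>\<sigma>\<close> a circuit reads only labels that agree with
  \<open>\<sigma>\<close> outside its own variables, so a step conditioned on one guard label
  neither sees nor disturbs the part of the vector that belongs to another. The same disjointness
  moves the rotation of the guard basis past the branch circuits; there linearity enters, as
  \<open>|e\<rangle>\<langle>\<psi>|\<close> mixes guard labels. One auxiliary register is chosen
  for the whole circuit and disjoint from all of it, since it has to guard the rotations at every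
  level of nesting. It must be finite-dimensional because branches form a list; the guard registers
  of the given circuit are so automatically, their bases being lists. All other spaces may be
  infinite-dimensional, and operators are controlled only on square-summable vectors. Intermediate
  vectors therefore have to be shown to lie in \<open>l2\<close>, which for
  \<open>A \<otimes> I\<close> rests on a norm bound for \<open>A\<close> that is uniform over the
  slices.\<close>

abbreviation sqn :: "'x vect \<Rightarrow> 'x \<Rightarrow> real" where
  "sqn v x \<equiv> (cmod (v x))\<^sup>2"

definition linear_on :: "'x set \<Rightarrow> 'x oper \<Rightarrow> bool" where
  "linear_on X A \<longleftrightarrow>
     (\<forall>v\<in>l2 X. A v \<in> l2 X) \<and>
     (\<forall>u\<in>l2 X. \<forall>v\<in>l2 X. A (\<lambda>x. u x + v x) = (\<lambda>x. A u x + A v x)) \<and>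
     (\<forall>c. \<forall>v\<in>l2 X. A (\<lambda>x. c * v x) = (\<lambda>x. c * A v x))"

text \<open>In infinite dimension linearity alone does not keep \<open>A \<otimes> I\<close> inside
  \<open>l2\<close>; the uniform \<open>K\<close> makes the norms of the slices summable in
  \<open>extend_l2\<close>.\<close>

definition bounded_on :: "'x set \<Rightarrow> 'x oper \<Rightarrow> bool" where
  "bounded_on X A \<longleftrightarrow>
     (\<exists>K. \<forall>v\<in>l2 X. (\<Sum>\<^sub>\<infinity>x\<in>X. sqn (A v) x) \<le> K * (\<Sum>\<^sub>\<infinity>x\<in>X. sqn v x))"

lemma l2_outside: "v \<in> l2 X \<Longrightarrow> x \<notin> X \<Longrightarrow> v x = 0"
  by (simp add: l2_def)

lemma l2_summable: "v \<in> l2 X \<Longrightarrow> sqn v summable_on X"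
  by (simp add: l2_def)

lemma l2I: "(\<And>x. x \<notin> X \<Longrightarrow> v x = 0) \<Longrightarrow> sqn v summable_on X \<Longrightarrow> v \<in> l2 X"
  by (simp add: l2_def)

lemma l2_zero: "(\<lambda>_. 0) \<in> l2 X"
  by (simp add: l2_def)

lemma l2_scale:
  assumes "v \<in> l2 X" shows "(\<lambda>x. c * v x) \<in> l2 X"
  using assms by (auto simp: l2_def norm_mult power_mult_distrib intro: summable_on_cmult_right)

lemma l2_add:
  assumes "u \<in> l2 X" "v \<in> l2 X" shows "(\<lambda>x. u x + v x) \<in> l2 X"
proof (rule l2I)
  have "sqn (\<lambda>x. u x + v x) x \<le> 2 * sqn u x + 2 * sqn v x" for x
  proof -
    have "sqn (\<lambda>x. u x + v x) x \<le> (cmod (u x) + cmod (v x))\<^sup>2"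
      by (intro power_mono norm_triangle_ineq) auto
    also have "\<dots> \<le> 2 * sqn u x + 2 * sqn v x"
      using sum_squares_bound[of "cmod (u x)" "cmod (v x)"] by (simp add: power2_sum)
    finally show ?thesis by simp
  qed
  moreover have "(\<lambda>x. 2 * sqn u x + 2 * sqn v x) summable_on X"
    using assms by (intro summable_on_add summable_on_cmult_right l2_summable)
  ultimately show "sqn (\<lambda>x. u x + v x) summable_on X"
    by (rule_tac summable_on_comparison_test) auto
qed (use assms in \<open>auto simp: l2_def\<close>)

lemma l2_sum:
  assumes "\<And>i. i \<in> I \<Longrightarrow> f i \<in> l2 X" shows "(\<lambda>x. \<Sum>i\<in>I. f i x) \<in> l2 X"
  using assms by (induction I rule: infinite_finite_induct) (auto simp: l2_zero intro: l2_add)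

lemma l2_finite: "finite X \<Longrightarrow> (\<And>x. x \<notin> X \<Longrightarrow> v x = 0) \<Longrightarrow> v \<in> l2 X"
  by (simp add: l2_def)

lemma l2_inner_summable:
  assumes "u \<in> l2 X" "v \<in> l2 X" shows "(\<lambda>x. cnj (u x) * v x) summable_on X"
proof -
  have "(\<lambda>x. sqn u x + sqn v x) summable_on X"
    using assms by (intro summable_on_add l2_summable)
  moreover have "cmod (cnj (u x) * v x) \<le> sqn u x + sqn v x" for x
  proof -
    have "2 * (cmod (u x) * cmod (v x)) \<le> sqn u x + sqn v x"
      using sum_squares_bound[of "cmod (u x)" "cmod (v x)"] by simp
    moreover have "0 \<le> cmod (u x) * cmod (v x)" by simp
    ultimately show ?thesis unfolding norm_mult complex_mod_cnj by linarith
  qed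
  ultimately have "(\<lambda>x. cnj (u x) * v x) abs_summable_on X"
    by (rule_tac summable_on_comparison_test[where f = "\<lambda>x. sqn u x + sqn v x"]) auto
  then show ?thesis by (rule abs_summable_summable)
qed

lemma l2_inner_sum_right:
  assumes "finite I" "u \<in> l2 X" "\<And>i. i \<in> I \<Longrightarrow> f i \<in> l2 X"
  shows "l2_inner X u (\<lambda>x. \<Sum>i\<in>I. c i * f i x) = (\<Sum>i\<in>I. c i * l2_inner X u (f i))"
  using assms(1,3)
proof (induction I)
  case empty
  then show ?case by (simp add: l2_inner_def)
next
  case (insert i I)
  have "(\<lambda>x. \<Sum>i\<in>I. c i * f i x) \<in> l2 X"
    using insert by (intro l2_sum l2_scale) auto
  moreover have "(\<lambda>x. c i * f i x) \<in> l2 X"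
    using insert by (intro l2_scale) auto
  ultimately have "l2_inner X u (\<lambda>x. c i * f i x + (\<Sum>i\<in>I. c i * f i x)) =
      l2_inner X u (\<lambda>x. c i * f i x) + l2_inner X u (\<lambda>x. \<Sum>i\<in>I. c i * f i x)"
    unfolding l2_inner_def using assms(2)
    by (simp add: distrib_left infsum_add l2_inner_summable)
  moreover have "l2_inner X u (\<lambda>x. c i * f i x) = c i * l2_inner X u (f i)"
    unfolding l2_inner_def using assms(2) insert
    by (simp add: mult.left_commute[of _ "c i"] infsum_cmult_right l2_inner_summable)
  ultimately show ?case using insert by simp
qed

lemma l2_inner_self:
  assumes "v \<in> l2 X" shows "l2_inner X v v = of_real (\<Sum>\<^sub>\<infinity>x\<in>X. sqn v x)"
proof -
  have "cnj (v x) * v x = of_real (sqn v x)" for x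
    by (metis complex_norm_square mult.commute)
  moreover have "(\<Sum>\<^sub>\<infinity>x\<in>X. complex_of_real (sqn v x)) = of_real (\<Sum>\<^sub>\<infinity>x\<in>X. sqn v x)"
    by (intro infsumI has_sum_of_real has_sum_infsum l2_summable assms)
  ultimately show ?thesis unfolding l2_inner_def by simp
qed

lemma ket_apply: "ket x y = (if y = x then 1 else 0)"
  by (simp add: ket_def)

lemma l2_inner_ket:
  assumes "x \<in> X" shows "l2_inner X (ket x) v = v x"
proof -
  have "l2_inner X (ket x) v = (\<Sum>\<^sub>\<infinity>y\<in>{x}. cnj (ket x y) * v y)"
    unfolding l2_inner_def by (rule infsum_cong_neutral) (use assms in \<open>auto simp: ket_def\<close>)
  then show ?thesis by (simp add: ket_def)
qed

lemma ket_in_l2: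
  assumes "x \<in> X" shows "ket x \<in> l2 X"
proof (rule l2I)
  have "sqn (ket x) summable_on X \<longleftrightarrow> sqn (ket x) summable_on {x}"
    by (rule summable_on_cong_neutral) (use assms in \<open>auto simp: ket_def\<close>)
  then show "sqn (ket x) summable_on X" by simp
qed (use assms in \<open>auto simp: ket_def\<close>)

section \<open>Orthonormal bases and dimension\<close>

lemma orthonormal_basis_kets:
  assumes "distinct es" "set es = X"
  shows "orthonormal_basis X (map ket es)"
  unfolding orthonormal_basis_def
proof (intro conjI allI impI ballI)
  show "set (map ket es) \<subseteq> l2 X" using assms by (auto intro: ket_in_l2)
  fix i j assume "i < length (map ket es)" "j < length (map ket es)"
  then show "l2_inner X (map ket es ! i) (map ket es ! j) = (if i = j then 1 else 0)"
    using assms by (auto simp: l2_inner_ket ket_apply nth_eq_iff_index_eq)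
next
  fix v assume v: "v \<in> l2 X"
  have "v y = (\<Sum>i<length (map ket es). v (es ! i) * (map ket es ! i) y)" for y
  proof -
    have "(\<Sum>i<length es. v (es ! i) * ket (es ! i) y) = (\<Sum>x\<in>X. v x * ket x y)"
      using sum.reindex_bij_betw[OF bij_betw_nth[OF assms(1) refl assms(2)[symmetric]], of "\<lambda>x. v x * ket x y"]
      by simp
    also have "\<dots> = (\<Sum>x\<in>X. if y = x then v x else 0)"
      by (intro sum.cong) (auto simp: ket_def)
    also have "\<dots> = v y"
      using assms v by (auto simp: l2_outside)
    finally show ?thesis by simp
  qed
  then show "\<exists>c. v = (\<lambda>x. \<Sum>i<length (map ket es). c i * (map ket es ! i) x)"
    by (intro exI[of _ "\<lambda>i. v (es ! i)"] ext)
qed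

text \<open>
  Both parts come from summing \<open>\<Sum>\<^sub>i |\<psi>\<^sub>i(x)|\<^sup>2 = 1\<close> over \<open>x\<close> (the trace of the identity).
\<close>

lemma orthonormal_basis_finite:
  assumes "orthonormal_basis X bs"
  shows "finite X" and "card X = length bs"
proof -
  have l2: "bs ! i \<in> l2 X" if "i < length bs" for i
    using assms that by (auto simp: orthonormal_basis_def)
  have inner: "l2_inner X (bs ! i) (bs ! j) = (if i = j then 1 else 0)"
    if "i < length bs" "j < length bs" for i j
    using assms that by (auto simp: orthonormal_basis_def)
  have norm1: "(\<Sum>\<^sub>\<infinity>x\<in>X. sqn (bs ! i) x) = 1" if "i < length bs" for i
    using inner[OF that that] l2[OF that] by (simp add: l2_inner_self)
  have one: "(\<Sum>i<length bs. sqn (bs ! i) x) = 1" if x: "x \<in> X" for x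
  proof -
    \<comment> \<open>Pairing this expansion with each basis vector determines its coefficients;
      evaluating it at \<open>x\<close> then gives the claim.\<close>
    obtain c where c: "ket x = (\<lambda>y. \<Sum>i<length bs. c i * (bs ! i) y)"
      using assms ket_in_l2[OF x] by (auto simp: orthonormal_basis_def)
    have "c j = cnj ((bs ! j) x)" if j: "j < length bs" for j
    proof -
      have "c j = (\<Sum>i<length bs. c i * l2_inner X (bs ! j) (bs ! i))"
        using j inner by (simp add: if_distrib[of "\<lambda>z. _ * z"] sum.delta cong: if_cong)
      also have "\<dots> = l2_inner X (bs ! j) (ket x)"
        unfolding c using j l2 by (intro l2_inner_sum_right[symmetric]) auto
      also have "\<dots> = (\<Sum>\<^sub>\<infinity>y\<in>{x}. cnj ((bs ! j) y) * ket x y)"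
        unfolding l2_inner_def by (rule infsum_cong_neutral) (use x in \<open>auto simp: ket_def\<close>)
      finally show ?thesis by (simp add: ket_def)
    qed
    moreover have "(1::complex) = (\<Sum>i<length bs. c i * (bs ! i) x)"
      using fun_cong[OF c, of x] by (simp add: ket_def)
    ultimately have "(1::complex) = (\<Sum>i<length bs. of_real (sqn (bs ! i) x))"
      by (simp add: complex_norm_square mult.commute del: of_real_power)
    then show ?thesis by (metis of_real_eq_1_iff of_real_sum)
  qed
  \<comment> \<open>Finite subsets come first: finiteness of \<open>X\<close> is still open, and for
    finite \<open>F\<close> the two sums can simply be exchanged.\<close>
  have card_le: "card F \<le> length bs" if F: "finite F" "F \<subseteq> X" for F
  proof -
    have "real (card F) = (\<Sum>x\<in>F. \<Sum>i<length bs. sqn (bs ! i) x)"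
      using one F by (simp add: subset_iff)
    also have "\<dots> = (\<Sum>i<length bs. \<Sum>x\<in>F. sqn (bs ! i) x)" by (rule sum.swap)
    also have "\<dots> \<le> (\<Sum>i<length bs. \<Sum>\<^sub>\<infinity>x\<in>X. sqn (bs ! i) x)"
      using F l2 by (intro sum_mono finite_sum_le_infsum l2_summable) auto
    also have "\<dots> = length bs" by (simp add: norm1)
    finally show ?thesis by simp
  qed
  show "finite X"
  proof (rule ccontr)
    assume "infinite X"
    then obtain F where "F \<subseteq> X" "finite F" "card F = Suc (length bs)"
      using infinite_arbitrarily_large by blast
    then show False using card_le[of F] by simp
  qed
  then have "real (card X) = (\<Sum>x\<in>X. \<Sum>i<length bs. sqn (bs ! i) x)"
    using one by simp
  also have "\<dots> = (\<Sum>i<length bs. \<Sum>x\<in>X. sqn (bs ! i) x)" by (rule sum.swap)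
  also have "\<dots> = length bs" using norm1 \<open>finite X\<close> by simp
  finally show "card X = length bs" by simp
qed

section \<open>Linear and bounded operators\<close>

lemma linear_onD:
  assumes "linear_on X A"
  shows "v \<in> l2 X \<Longrightarrow> A v \<in> l2 X"
    and "u \<in> l2 X \<Longrightarrow> v \<in> l2 X \<Longrightarrow> A (\<lambda>x. u x + v x) = (\<lambda>x. A u x + A v x)"
    and "v \<in> l2 X \<Longrightarrow> A (\<lambda>x. c * v x) = (\<lambda>x. c * A v x)"
  using assms by (auto simp: linear_on_def)

lemma linear_on_zero: "linear_on X A \<Longrightarrow> A (\<lambda>_. 0) = (\<lambda>_. 0)"
  using linear_onD(3)[OF _ l2_zero, of X A 0] by simp

lemma linear_on_sum:
  assumes "linear_on X A" "\<And>i. i \<in> I \<Longrightarrow> f i \<in> l2 X"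
  shows "A (\<lambda>x. \<Sum>i\<in>I. c i * f i x) = (\<lambda>x. \<Sum>i\<in>I. c i * A (f i) x)"
  using assms(2)
proof (induction I rule: infinite_finite_induct)
  case (insert i I)
  have "(\<lambda>x. \<Sum>i\<in>I. c i * f i x) \<in> l2 X" "(\<lambda>x. c i * f i x) \<in> l2 X"
    using insert by (auto intro!: l2_sum l2_scale)
  then have "A (\<lambda>x. c i * f i x + (\<Sum>i\<in>I. c i * f i x)) =
      (\<lambda>x. A (\<lambda>x. c i * f i x) x + A (\<lambda>x. \<Sum>i\<in>I. c i * f i x) x)"
    using assms(1) by (intro linear_onD(2))
  then show ?case
    using insert linear_onD(3)[OF assms(1), of "f i" "c i"] by simp
qed (use linear_on_zero[OF assms(1)] in auto)

lemma linear_on_comp: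
  "linear_on X A \<Longrightarrow> linear_on X B \<Longrightarrow> linear_on X (A \<circ> B)"
  by (simp add: linear_on_def)

lemma linear_on_add:
  assumes "linear_on X A" "linear_on X B"
  shows "linear_on X (\<lambda>v x. A v x + B v x)"
  using assms unfolding linear_on_def by (simp add: l2_add algebra_simps)

lemma linear_on_sum_list:
  assumes "\<And>a. a \<in> set as \<Longrightarrow> linear_on X (A a)"
  shows "linear_on X (\<lambda>v x. \<Sum>a\<leftarrow>as. A a v x)"
  using assms
proof (induction as)
  case Nil
  then show ?case by (simp add: linear_on_def l2_zero)
next
  case (Cons a as)
  then show ?case by (simp add: linear_on_add)
qed

lemma unitary_on_linear_bounded:
  assumes "unitary_on X U" shows "linear_on X U" "bounded_on X U"
proof -
  show "linear_on X U" using assms by (auto simp: unitary_on_def linear_on_def)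
  have "(\<Sum>\<^sub>\<infinity>x\<in>X. sqn (U v) x) = (\<Sum>\<^sub>\<infinity>x\<in>X. sqn v x)" if "v \<in> l2 X" for v
  proof -
    have "U v \<in> l2 X" "l2_inner X (U v) (U v) = l2_inner X v v"
      using assms that by (auto simp: unitary_on_def)
    then show ?thesis using that by (simp add: l2_inner_self)
  qed
  then show "bounded_on X U" unfolding bounded_on_def by (intro exI[of _ 1]) auto
qed

text \<open>The bound is Cauchy-Schwarz, with \<open>K\<close> the product of the squared norms of
  \<open>\<phi>\<close> and \<open>\<psi>\<close>.\<close>

lemma ketbra_linear_bounded:
  assumes "finite X" "\<phi> \<in> l2 X"
  shows "linear_on X (ketbra X \<phi> \<psi>)" "bounded_on X (ketbra X \<phi> \<psi>)"
proof -
  show "linear_on X (ketbra X \<phi> \<psi>)"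
    using assms unfolding linear_on_def ketbra_def l2_inner_def
    by (auto simp: l2_outside algebra_simps sum.distrib sum_distrib_left intro!: l2_finite)
  have "(\<Sum>x\<in>X. sqn (ketbra X \<phi> \<psi> v) x) \<le> (\<Sum>x\<in>X. sqn \<phi> x) * (\<Sum>x\<in>X. sqn \<psi> x) * (\<Sum>x\<in>X. sqn v x)"
    for v
  proof -
    have "cmod (l2_inner X \<psi> v) \<le> (\<Sum>x\<in>X. cmod (\<psi> x) * cmod (v x))"
      unfolding l2_inner_def using assms(1) by (auto simp: norm_mult intro: order_trans[OF norm_sum])
    then have "(cmod (l2_inner X \<psi> v))\<^sup>2 \<le> (\<Sum>x\<in>X. cmod (\<psi> x) * cmod (v x))\<^sup>2"
      by (rule power_mono) simp
    also have "\<dots> \<le> (\<Sum>x\<in>X. sqn \<psi> x) * (\<Sum>x\<in>X. sqn v x)"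
      by (rule Cauchy_Schwarz_ineq_sum)
    finally have "(\<Sum>x\<in>X. sqn \<phi> x) * (cmod (l2_inner X \<psi> v))\<^sup>2 \<le>
        (\<Sum>x\<in>X. sqn \<phi> x) * ((\<Sum>x\<in>X. sqn \<psi> x) * (\<Sum>x\<in>X. sqn v x))"
      by (intro mult_left_mono sum_nonneg) auto
    then show ?thesis
      by (simp add: ketbra_def norm_mult power_mult_distrib sum_distrib_right mult.assoc)
  qed
  then show "bounded_on X (ketbra X \<phi> \<psi>)"
    unfolding bounded_on_def using assms(1) by auto
qed

section \<open>Extension of operators to larger registers\<close>

definition overlay :: "'q set \<Rightarrow> ('q \<Rightarrow> 'b) \<Rightarrow> ('q \<Rightarrow> 'b) \<Rightarrow> 'q \<Rightarrow> 'b" where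
  "overlay S \<tau> \<sigma> = (\<lambda>q. if q \<in> S then \<tau> q else \<sigma> q)"

text \<open>This is the vector \<open>v\<^sub>\<rho>\<close> from the description of
  \<open>extend\<close>. It depends on \<open>\<sigma>\<close> only outside \<open>S\<close>, which
  makes extended operators local.\<close>

definition slice ::
  "('q, 'b, 'u) qsig \<Rightarrow> 'q set \<Rightarrow> ('q \<Rightarrow> 'b) vect \<Rightarrow> ('q \<Rightarrow> 'b) \<Rightarrow> ('q \<Rightarrow> 'b) vect" where
  "slice Q S v \<sigma> = (\<lambda>\<tau>. if \<tau> \<in> assigns Q S then v (overlay S \<tau> \<sigma>) else 0)"

lemma extend_eq:
  "extend Q S W A v \<sigma> = (if \<sigma> \<in> assigns Q W then A (slice Q S v \<sigma>) (restrict \<sigma> S) else 0)"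
  by (simp add: extend_def slice_def overlay_def cong: if_cong)

lemma assigns_restrict: "\<sigma> \<in> assigns Q W \<Longrightarrow> S \<subseteq> W \<Longrightarrow> restrict \<sigma> S \<in> assigns Q S"
  by (auto simp: assigns_def)

lemma assigns_overlay:
  "\<tau> \<in> assigns Q S \<Longrightarrow> \<sigma> \<in> assigns Q W \<Longrightarrow> S \<subseteq> W \<Longrightarrow> overlay S \<tau> \<sigma> \<in> assigns Q W"
  by (auto simp: assigns_def overlay_def PiE_iff extensional_def)

lemma restrict_overlay: "\<tau> \<in> assigns Q S \<Longrightarrow> restrict (overlay S \<tau> \<sigma>) S = \<tau>"
  by (auto simp: assigns_def overlay_def fun_eq_iff PiE_iff extensional_def)

lemma overlay_overlay: "overlay S \<tau> (overlay S \<rho> \<sigma>) = overlay S \<tau> \<sigma>"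
  by (auto simp: overlay_def)

lemma overlay_commute: "S \<inter> T = {} \<Longrightarrow> overlay S \<rho> (overlay T \<tau> \<sigma>) = overlay T \<tau> (overlay S \<rho> \<sigma>)"
  by (auto simp: overlay_def fun_eq_iff)

lemma overlay_restrict: "overlay S (restrict \<sigma> S) \<sigma> = \<sigma>"
  by (auto simp: overlay_def)

lemma restrict_overlay_disjoint: "S \<inter> T = {} \<Longrightarrow> restrict (overlay S \<rho> \<sigma>) T = restrict \<sigma> T"
  by (auto simp: overlay_def fun_eq_iff restrict_def)

lemma slice_overlay: "slice Q S v (overlay S \<tau> \<sigma>) = slice Q S v \<sigma>"
  by (simp add: slice_def overlay_overlay cong: if_cong)

lemma slice_restrict: "\<sigma> \<in> assigns Q W \<Longrightarrow> S \<subseteq> W \<Longrightarrow> slice Q S v \<sigma> (restrict \<sigma> S) = v \<sigma>"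
  by (simp add: slice_def overlay_restrict assigns_restrict)

text \<open>Slicing twice is slicing once along the smaller set, so \<open>A\<close> receives the
  same vector on both sides. The nested extensions in \<open>sem\<close> thereby collapse into
  one.\<close>

lemma extend_extend:
  assumes "R \<subseteq> S" "S \<subseteq> W"
  shows "extend Q S W (extend Q R S A) = extend Q R W A"
proof (intro ext)
  fix v \<sigma>
  show "extend Q S W (extend Q R S A) v \<sigma> = extend Q R W A v \<sigma>"
  proof (cases "\<sigma> \<in> assigns Q W")
    case True
    have "slice Q R (slice Q S v \<sigma>) (restrict \<sigma> S) = slice Q R v \<sigma>"
    proof
      fix \<tau>
      have "overlay R \<tau> (restrict \<sigma> S) \<in> assigns Q S" if "\<tau> \<in> assigns Q R"
        using that assigns_restrict[OF True assms(2)] assms(1) by (rule assigns_overlay)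
      moreover have "overlay S (overlay R \<tau> (restrict \<sigma> S)) \<sigma> = overlay R \<tau> \<sigma>"
        using assms(1) by (auto simp: overlay_def fun_eq_iff)
      ultimately show "slice Q R (slice Q S v \<sigma>) (restrict \<sigma> S) \<tau> = slice Q R v \<sigma> \<tau>"
        by (simp add: slice_def)
    qed
    then show ?thesis
      using True assms by (simp add: extend_eq assigns_restrict Int_absorb1)
  qed (simp add: extend_eq)
qed

lemma slice_extend:
  assumes "S \<subseteq> W" "\<sigma> \<in> assigns Q W"
  shows "slice Q S (extend Q S W A v) \<sigma> =
    (\<lambda>\<tau>. if \<tau> \<in> assigns Q S then A (slice Q S v \<sigma>) \<tau> else 0)"
  using assms
  by (auto simp: slice_def[of Q S "extend Q S W A v"] extend_eq assigns_overlay slice_overlay restrict_overlay)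

text \<open>Slices are cut off to 0 outside \<open>assigns Q S\<close>; the condition on
  \<open>B\<close> ensures that this cut-off leaves the vector handed to \<open>A\<close>
  unchanged.\<close>

lemma extend_comp:
  assumes "S \<subseteq> W" "\<And>v \<tau>. \<tau> \<notin> assigns Q S \<Longrightarrow> B v \<tau> = 0"
  shows "extend Q S W (A \<circ> B) v = extend Q S W A (extend Q S W B v)"
proof
  fix \<sigma>
  have "slice Q S (extend Q S W B v) \<sigma> = B (slice Q S v \<sigma>)" if "\<sigma> \<in> assigns Q W"
    using assms that by (auto simp: slice_extend)
  then show "extend Q S W (A \<circ> B) v \<sigma> = extend Q S W A (extend Q S W B v) \<sigma>"
    by (simp add: extend_eq)
qed

lemma extend_outside: "\<sigma> \<notin> assigns Q W \<Longrightarrow> extend Q S W A v \<sigma> = 0"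
  by (simp add: extend_eq)

lemma extend_sum_list:
  "extend Q S W (\<lambda>v \<sigma>. \<Sum>a\<leftarrow>as. A a v \<sigma>) v \<sigma> = (\<Sum>a\<leftarrow>as. extend Q S W (A a) v \<sigma>)"
  by (simp add: extend_eq sum_list_0)

text \<open>The splitting of the standard basis of \<open>W\<close> behind \<open>\<H>\<^bsub>W\<^esub> = \<H>\<^bsub>W - S\<^esub> \<otimes> \<H>\<^bsub>S\<^esub>\<close>.\<close>

lemma bij_betw_overlay:
  assumes "S \<subseteq> W"
  shows "bij_betw (\<lambda>(\<rho>, \<tau>). overlay S \<tau> \<rho>) (assigns Q (W - S) \<times> assigns Q S) (assigns Q W)"
proof (rule bij_betw_byWitness[where f' = "\<lambda>\<sigma>. (restrict \<sigma> (W - S), restrict \<sigma> S)"])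
  show "\<forall>a\<in>assigns Q (W - S) \<times> assigns Q S.
      (\<lambda>\<sigma>. (restrict \<sigma> (W - S), restrict \<sigma> S)) ((\<lambda>(\<rho>, \<tau>). overlay S \<tau> \<rho>) a) = a"
    by (auto simp: assigns_def overlay_def PiE_iff extensional_def fun_eq_iff restrict_def)
  show "\<forall>\<sigma>\<in>assigns Q W.
      (\<lambda>(\<rho>, \<tau>). overlay S \<tau> \<rho>) (restrict \<sigma> (W - S), restrict \<sigma> S) = \<sigma>"
    using assms by (auto simp: assigns_def overlay_def PiE_iff extensional_def fun_eq_iff restrict_def)
  show "(\<lambda>(\<rho>, \<tau>). overlay S \<tau> \<rho>) ` (assigns Q (W - S) \<times> assigns Q S) \<subseteq> assigns Q W"
    using assms by (auto simp: assigns_def overlay_def PiE_iff extensional_def)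
  show "(\<lambda>\<sigma>. (restrict \<sigma> (W - S), restrict \<sigma> S)) ` assigns Q W \<subseteq> assigns Q (W - S) \<times> assigns Q S"
    using assms by (auto simp: assigns_def)
qed

lemma finite_assigns_Un:
  assumes "finite (assigns Q S)" "finite (assigns Q T)"
  shows "finite (assigns Q (S \<union> T))"
proof -
  have "finite ((\<lambda>\<tau>. restrict \<tau> (T - S)) ` assigns Q T)" using assms(2) by simp
  moreover have "assigns Q (S \<union> T) \<subseteq>
      (\<lambda>(\<rho>, \<tau>). overlay S \<tau> \<rho>) ` (((\<lambda>\<tau>. restrict \<tau> (T - S)) ` assigns Q T) \<times> assigns Q S)"
  proof
    fix \<sigma> assume \<sigma>: "\<sigma> \<in> assigns Q (S \<union> T)"
    then have "restrict (restrict \<sigma> T) (T - S) \<in> (\<lambda>\<tau>. restrict \<tau> (T - S)) ` assigns Q T"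
      "restrict \<sigma> S \<in> assigns Q S"
      by (blast intro: assigns_restrict)+
    moreover have "\<sigma> = overlay S (restrict \<sigma> S) (restrict (restrict \<sigma> T) (T - S))"
      using \<sigma> by (auto simp: assigns_def overlay_def PiE_iff extensional_def fun_eq_iff restrict_def)
    ultimately show "\<sigma> \<in> (\<lambda>(\<rho>, \<tau>). overlay S \<tau> \<rho>) `
        (((\<lambda>\<tau>. restrict \<tau> (T - S)) ` assigns Q T) \<times> assigns Q S)"
      by (auto intro!: image_eqI[of _ _ "(restrict (restrict \<sigma> T) (T - S), restrict \<sigma> S)"])
  qed
  ultimately show ?thesis using assms(1) by (meson finite_SigmaI finite_imageI finite_subset)
qed

lemma slice_l2:
  assumes "v \<in> l2 (assigns Q W)" "S \<subseteq> W" "\<sigma> \<in> assigns Q W"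
  shows "slice Q S v \<sigma> \<in> l2 (assigns Q S)"
proof (rule l2I)
  have "inj_on (\<lambda>\<tau>. overlay S \<tau> \<sigma>) (assigns Q S)"
    by (rule inj_onI) (metis restrict_overlay)
  moreover have "sqn v summable_on (\<lambda>\<tau>. overlay S \<tau> \<sigma>) ` assigns Q S"
    using l2_summable[OF assms(1)]
    by (rule summable_on_subset_banach) (use assms assigns_overlay in blast)
  ultimately have "(\<lambda>\<tau>. sqn v (overlay S \<tau> \<sigma>)) summable_on assigns Q S"
    by (simp add: summable_on_reindex o_def)
  then show "sqn (slice Q S v \<sigma>) summable_on assigns Q S"
    by (rule summable_on_cong[THEN iffD1, rotated]) (simp add: slice_def)
qed (simp add: slice_def)

text \<open>The squared norm of \<open>v\<close> is the sum of those of its slices over the labels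
  of \<open>W - S\<close>. The constant \<open>K\<close> bounds each slice of the result by the
  corresponding slice of \<open>v\<close>, and summability over all pairs of labels follows by
  comparison.\<close>

lemma extend_l2:
  assumes "S \<subseteq> W" "linear_on (assigns Q S) A" "bounded_on (assigns Q S) A" "v \<in> l2 (assigns Q W)"
  shows "extend Q S W A v \<in> l2 (assigns Q W)"
proof (rule l2I)
  let ?R = "assigns Q (W - S)" and ?T = "assigns Q S"
  note bij = summable_on_reindex_bij_betw[OF bij_betw_overlay[OF assms(1)], symmetric]
  obtain K where K: "(\<Sum>\<^sub>\<infinity>x\<in>?T. sqn (A v) x) \<le> K * (\<Sum>\<^sub>\<infinity>x\<in>?T. sqn v x)" if "v \<in> l2 ?T" for v
    using assms(3) by (auto simp: bounded_on_def)
  have "(\<lambda>(\<rho>, \<tau>). sqn v (overlay S \<tau> \<rho>)) summable_on ?R \<times> ?T"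
    using l2_summable[OF assms(4)] unfolding bij by (simp add: case_prod_unfold)
  then have sum: "(\<lambda>(\<rho>, \<tau>). sqn (slice Q S v \<rho>) \<tau>) summable_on ?R \<times> ?T"
    by (rule summable_on_cong[THEN iffD1, rotated]) (auto simp: slice_def)
  have sl: "slice Q S v \<rho> \<in> l2 ?T" if "\<rho> \<in> ?R" for \<rho>
  proof (rule l2I)
    show "sqn (slice Q S v \<rho>) summable_on ?T"
      using summable_on_SigmaD1[OF sum that] by simp
  qed (simp add: slice_def)
  have "(\<lambda>\<rho>. K * (\<Sum>\<^sub>\<infinity>\<tau>\<in>?T. sqn (slice Q S v \<rho>) \<tau>)) summable_on ?R"
    by (intro summable_on_cmult_right summable_on_Sigma_banach sum)
  then have "(\<lambda>\<rho>. \<Sum>\<^sub>\<infinity>\<tau>\<in>?T. sqn (A (slice Q S v \<rho>)) \<tau>) summable_on ?R"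
    by (rule summable_on_comparison_test) (auto intro!: K sl infsum_nonneg)
  moreover have "((\<lambda>\<tau>. sqn (A (slice Q S v \<rho>)) \<tau>) has_sum (\<Sum>\<^sub>\<infinity>\<tau>\<in>?T. sqn (A (slice Q S v \<rho>)) \<tau>)) ?T"
    if "\<rho> \<in> ?R" for \<rho>
    by (intro has_sum_infsum l2_summable linear_onD(1)[OF assms(2)] sl that)
  ultimately have "(\<lambda>(\<rho>, \<tau>). sqn (A (slice Q S v \<rho>)) \<tau>) summable_on ?R \<times> ?T"
    by (intro summable_on_SigmaI[where g = "\<lambda>\<rho>. \<Sum>\<^sub>\<infinity>\<tau>\<in>?T. sqn (A (slice Q S v \<rho>)) \<tau>"]) auto
  then have "(\<lambda>(\<rho>, \<tau>). sqn (extend Q S W A v) (overlay S \<tau> \<rho>)) summable_on ?R \<times> ?T"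
  proof (rule summable_on_cong[THEN iffD1, rotated])
    fix p assume p: "p \<in> ?R \<times> ?T"
    obtain \<rho> \<tau> where [simp]: "p = (\<rho>, \<tau>)" by force
    have "overlay S \<tau> \<rho> \<in> assigns Q W"
      using bij_betwE[OF bij_betw_overlay[OF assms(1)]] p by fastforce
    then show "(case p of (\<rho>, \<tau>) \<Rightarrow> sqn (A (slice Q S v \<rho>)) \<tau>) =
        (case p of (\<rho>, \<tau>) \<Rightarrow> sqn (extend Q S W A v) (overlay S \<tau> \<rho>))"
      using p by (simp add: extend_eq slice_overlay restrict_overlay[of _ Q])
  qed
  then show "sqn (extend Q S W A v) summable_on assigns Q W"
    unfolding bij by (simp add: case_prod_unfold)
qed (simp add: extend_eq)

lemma slice_add: "slice Q S (\<lambda>x. u x + v x) \<sigma> = (\<lambda>x. slice Q S u \<sigma> x + slice Q S v \<sigma> x)"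
  and slice_scale: "slice Q S (\<lambda>x. c * v x) \<sigma> = (\<lambda>x. c * slice Q S v \<sigma> x)"
  by (auto simp: slice_def)

lemma linear_on_extend:
  assumes "S \<subseteq> W" "linear_on (assigns Q S) A" "bounded_on (assigns Q S) A"
  shows "linear_on (assigns Q W) (extend Q S W A)"
  using assms extend_l2[OF assms] unfolding linear_on_def[of "assigns Q W"]
  by (auto simp: fun_eq_iff extend_eq slice_add slice_scale slice_l2 linear_onD(2,3)[OF assms(2)])

section \<open>Basic gates as operators on labelled registers\<close>

lemma listset_iff: "xs \<in> listset As \<longleftrightarrow> list_all2 (\<in>) xs As"
  by (induction As arbitrary: xs) (auto simp: set_Cons_def list_all2_Cons2)

definition untuple :: "'q list \<Rightarrow> 'b list \<Rightarrow> 'q \<Rightarrow> 'b" where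
  "untuple qs xs q = (case map_of (zip qs xs) q of Some b \<Rightarrow> b | None \<Rightarrow> undefined)"

lemma bij_betw_tuple:
  assumes "distinct qs"
  shows "bij_betw (\<lambda>\<sigma>. map \<sigma> qs) (assigns Q (set qs)) (listset (map (labels Q) qs))"
proof (rule bij_betw_byWitness[where f' = "untuple qs"])
  show "\<forall>\<sigma>\<in>assigns Q (set qs). untuple qs (map \<sigma> qs) = \<sigma>"
    by (auto simp: untuple_def assigns_def fun_eq_iff map_of_zip_map PiE_iff extensional_def)
  have nth: "untuple qs xs (qs ! i) = xs ! i" if "i < length qs" "length xs = length qs" for xs :: "'b list" and i
    using that assms by (simp add: untuple_def map_of_zip_nth)
  show "\<forall>xs\<in>listset (map (labels Q) qs). map (untuple qs xs) qs = xs"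
  proof
    fix xs assume "xs \<in> listset (map (labels Q) qs)"
    then have "length xs = length qs"
      by (auto simp: listset_iff dest: list_all2_lengthD)
    then show "map (untuple qs xs) qs = xs" using nth by (intro nth_equalityI) auto
  qed
  show "(\<lambda>\<sigma>. map \<sigma> qs) ` assigns Q (set qs) \<subseteq> listset (map (labels Q) qs)"
    by (auto simp: listset_iff list_all2_map1 list_all2_map2 list_all2_same assigns_def)
  show "untuple qs ` listset (map (labels Q) qs) \<subseteq> assigns Q (set qs)"
  proof
    fix \<sigma> assume "\<sigma> \<in> untuple qs ` listset (map (labels Q) qs)"
    then obtain xs where \<sigma>: "\<sigma> = untuple qs xs" and "list_all2 (\<in>) xs (map (labels Q) qs)"
      by (auto simp: listset_iff)
    then have len: "length xs = length qs" and lab: "\<forall>i<length qs. xs ! i \<in> labels Q (qs ! i)"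
      by (auto simp: list_all2_conv_all_nth)
    have "\<sigma> q \<in> labels Q q" if "q \<in> set qs" for q
      using that lab nth[OF _ len] unfolding \<sigma> by (metis in_set_conv_nth)
    moreover have "\<sigma> q = undefined" if "q \<notin> set qs" for q
    proof -
      have "map_of (zip qs xs) q = None" using that len by (simp add: map_of_zip_is_None)
      then show ?thesis by (simp add: \<sigma> untuple_def)
    qed
    ultimately show "\<sigma> \<in> assigns Q (set qs)" by (auto simp: assigns_def)
  qed
qed

text \<open>Constants act on tuples, circuits on assignments. Relabelling the basis along a
  bijection preserves norms, hence also the bound \<open>K\<close>; the form of \<open>A\<close>
  with its two cut-offs is that of \<open>gate_op\<close>.\<close>

lemma linear_bounded_reindex:
  assumes bij: "bij_betw f X Y" and inv: "\<And>x. x \<in> X \<Longrightarrow> g (f x) = x"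
    and B: "linear_on Y B" "bounded_on Y B"
    and A: "\<And>v. A v = (\<lambda>x. if x \<in> X then B (\<lambda>y. if y \<in> Y then v (g y) else 0) (f x) else 0)"
  shows "linear_on X A" "bounded_on X A"
proof -
  define T where "T = (\<lambda>v y. if y \<in> Y then v (g y) else (0::complex))"
  have f: "f x \<in> Y" if "x \<in> X" for x using bij that by (auto simp: bij_betw_def)
  have A': "A v x = (if x \<in> X then B (T v) (f x) else 0)" for v x
    unfolding A T_def ..
  note summ = summable_on_reindex_bij_betw[OF bij, symmetric]
  note inf = infsum_reindex_bij_betw[OF bij, symmetric]
  have T: "T v \<in> l2 Y" "(\<Sum>\<^sub>\<infinity>y\<in>Y. sqn (T v) y) = (\<Sum>\<^sub>\<infinity>x\<in>X. sqn v x)" if v: "v \<in> l2 X" for v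
  proof -
    have eq: "sqn (T v) (f x) = sqn v x" if "x \<in> X" for x
      using that f inv by (simp add: T_def)
    show "T v \<in> l2 Y"
    proof (rule l2I)
      show "sqn (T v) summable_on Y"
        unfolding summ using l2_summable[OF v]
        by (rule summable_on_cong[THEN iffD1, rotated]) (simp add: eq)
    qed (simp add: T_def)
    show "(\<Sum>\<^sub>\<infinity>y\<in>Y. sqn (T v) y) = (\<Sum>\<^sub>\<infinity>x\<in>X. sqn v x)"
      unfolding inf by (rule infsum_cong) (simp add: eq)
  qed
  have "A v \<in> l2 X" if v: "v \<in> l2 X" for v
  proof (rule l2I)
    have "sqn (B (T v)) summable_on Y"
      by (intro l2_summable linear_onD(1)[OF B(1)] T v)
    then show "sqn (A v) summable_on X"
      unfolding summ by (rule summable_on_cong[THEN iffD1, rotated]) (simp add: A')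
  qed (simp add: A')
  moreover have "T (\<lambda>x. u x + v x) = (\<lambda>y. T u y + T v y)" "T (\<lambda>x. c * v x) = (\<lambda>y. c * T v y)" for u v c
    by (auto simp: T_def)
  ultimately show "linear_on X A"
    unfolding linear_on_def by (auto intro!: ext simp: A' linear_onD[OF B(1)] T)
  obtain K where K: "(\<Sum>\<^sub>\<infinity>y\<in>Y. sqn (B v) y) \<le> K * (\<Sum>\<^sub>\<infinity>y\<in>Y. sqn v y)" if "v \<in> l2 Y" for v
    using B(2) by (auto simp: bounded_on_def)
  have "(\<Sum>\<^sub>\<infinity>x\<in>X. sqn (A v) x) \<le> K * (\<Sum>\<^sub>\<infinity>x\<in>X. sqn v x)" if v: "v \<in> l2 X" for v
  proof -
    have "(\<Sum>\<^sub>\<infinity>x\<in>X. sqn (A v) x) = (\<Sum>\<^sub>\<infinity>y\<in>Y. sqn (B (T v)) y)"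
      unfolding inf by (rule infsum_cong) (simp add: A')
    then show ?thesis using K[OF T(1)[OF v]] T(2)[OF v] by simp
  qed
  then show "bounded_on X A" unfolding bounded_on_def by blast
qed

lemma gate_op_linear_bounded:
  assumes "quantum_signature Q" "wf_circ Q (Gate u qs)"
  shows "linear_on (assigns Q (set qs)) (gate_op Q u qs)"
    and "bounded_on (assigns Q (set qs)) (gate_op Q u qs)"
proof -
  have ty: "ctype Q u = map (labels Q) qs" and "distinct qs"
    using assms(2) by (auto simp: is_register_def)
  have "unitary_on (listset (ctype Q u)) (cop Q u)"
    using assms by (auto simp: quantum_signature_def)
  note cop = unitary_on_linear_bounded[OF this]
  have inv: "untuple qs (map \<sigma> qs) = \<sigma>" if "\<sigma> \<in> assigns Q (set qs)" for \<sigma>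
    using that by (auto simp: untuple_def assigns_def fun_eq_iff map_of_zip_map PiE_iff extensional_def)
  note * = linear_bounded_reindex[OF bij_betw_tuple[OF \<open>distinct qs\<close>, of Q, folded ty] inv cop]
  show "linear_on (assigns Q (set qs)) (gate_op Q u qs)"
    by (rule *) (auto simp: gate_op_def untuple_def cong: if_cong)
  show "bounded_on (assigns Q (set qs)) (gate_op Q u qs)"
    by (rule *) (auto simp: gate_op_def untuple_def cong: if_cong)
qed

section \<open>Circuits acting on larger registers\<close>

text \<open>On a common ambient register \<open>W\<close>, \<open>Seq\<close> becomes plain
  composition and circuits with different variables can be compared; \<open>equivalent\<close> is
  the case \<open>W = qv C \<union> qv D\<close>.\<close>

definition gsem ::
  "('q, 'b, 'u) qsig \<Rightarrow> 'q set \<Rightarrow> ('q, 'b, 'u) circ \<Rightarrow> ('q \<Rightarrow> 'b) oper" where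
  "gsem Q W C = extend Q (qv C) W (sem Q C)"

lemma gsem_outside: "\<sigma> \<notin> assigns Q W \<Longrightarrow> gsem Q W C v \<sigma> = 0"
  by (simp add: gsem_def extend_outside)

lemma gsem_extend: "qv C \<subseteq> S \<Longrightarrow> S \<subseteq> W \<Longrightarrow> gsem Q W C = extend Q S W (gsem Q S C)"
  by (simp add: gsem_def extend_extend)

text \<open>Extended operators return 0 outside \<open>assigns Q W\<close>, so \<open>v\<close> has
  to vanish there as well.\<close>

lemma gsem_Skip:
  assumes "v \<in> l2 (assigns Q W)" shows "gsem Q W Skip v = v"
proof
  fix \<sigma>
  show "gsem Q W Skip v \<sigma> = v \<sigma>"
    using assms by (auto simp: gsem_def extend_eq slice_restrict l2_outside)
qed

lemma gsem_Seq:
  assumes "qv C \<union> qv D \<subseteq> W"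
  shows "gsem Q W (Seq C D) v = gsem Q W D (gsem Q W C v)"
proof -
  have "gsem Q W (Seq C D) v =
      extend Q (qv C \<union> qv D) W (extend Q (qv D) (qv C \<union> qv D) (sem Q D))
        (extend Q (qv C \<union> qv D) W (extend Q (qv C) (qv C \<union> qv D) (sem Q C)) v)"
    unfolding gsem_def sem.simps qv.simps by (rule extend_comp[OF assms]) (rule extend_outside)
  then show ?thesis using assms by (simp add: extend_extend gsem_def)
qed

lemma gsem_QIf:
  assumes "qv (QIf qs bs) \<subseteq> W"
  shows "gsem Q W (QIf qs bs) v \<sigma> =
    (\<Sum>(\<psi>, C)\<leftarrow>bs. extend Q (set qs) W (ketbra (assigns Q (set qs)) \<psi> \<psi>) (gsem Q W C v) \<sigma>)"
proof -
  define V where "V = qv (QIf qs bs)"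
  define K where "K = (\<lambda>b::('a \<Rightarrow> 'b) vect \<times> ('a, 'b, 'c) circ.
    extend Q (set qs) V (ketbra (assigns Q (set qs)) (fst b) (fst b)))"
  define E where "E = (\<lambda>b::('a \<Rightarrow> 'b) vect \<times> ('a, 'b, 'c) circ. extend Q (qv (snd b)) V (sem Q (snd b)))"
  have sem: "sem Q (QIf qs bs) = (\<lambda>v \<sigma>. \<Sum>b\<leftarrow>bs. (K b \<circ> E b) v \<sigma>)"
    by (simp add: K_def E_def V_def case_prod_unfold Let_def)
  have "gsem Q W (QIf qs bs) v \<sigma> = (\<Sum>b\<leftarrow>bs. extend Q V W (K b \<circ> E b) v \<sigma>)"
    unfolding gsem_def sem V_def[symmetric] by (rule extend_sum_list)
  also have "\<dots> = (\<Sum>b\<leftarrow>bs. extend Q (set qs) W (ketbra (assigns Q (set qs)) (fst b) (fst b))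
      (gsem Q W (snd b) v) \<sigma>)"
  proof (rule arg_cong[of _ _ sum_list], rule map_cong[OF refl])
    fix b assume b: "b \<in> set bs"
    have sub: "V \<subseteq> W" "set qs \<subseteq> V" "qv (snd b) \<subseteq> V"
      using assms b by (auto simp: V_def)
    have "extend Q V W (K b \<circ> E b) v = extend Q V W (K b) (extend Q V W (E b) v)"
      by (rule extend_comp) (simp_all add: sub E_def extend_outside)
    then show "extend Q V W (K b \<circ> E b) v \<sigma> =
        extend Q (set qs) W (ketbra (assigns Q (set qs)) (fst b) (fst b)) (gsem Q W (snd b) v) \<sigma>"
      using sub by (simp add: K_def E_def extend_extend gsem_def)
  qed
  finally show ?thesis by (simp add: case_prod_unfold)
qed

section \<open>Linearity and locality of circuits\<close>

lemma guard_finite: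
  assumes "wf_circ Q (QIf qs bs)"
  shows "finite (assigns Q (set qs))" "card (assigns Q (set qs)) = length bs"
  using orthonormal_basis_finite[of "assigns Q (set qs)" "map fst bs"] assms by auto

lemma guard_in_l2:
  assumes "wf_circ Q (QIf qs bs)" "b \<in> set bs"
  shows "fst b \<in> l2 (assigns Q (set qs))"
  using assms by (auto simp: orthonormal_basis_def)

lemma linear_on_ketbra_extend:
  assumes "finite (assigns Q S)" "\<phi> \<in> l2 (assigns Q S)" "S \<subseteq> W"
  shows "linear_on (assigns Q W) (extend Q S W (ketbra (assigns Q S) \<phi> \<psi>))"
  using assms by (intro linear_on_extend ketbra_linear_bounded)

text \<open>Viewed on \<open>W\<close>, composites are sums and compositions of operators that are
  already extended. Norm bounds are thus called for only at gates and guard projectors, and the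
  induction carries linearity alone.\<close>

lemma linear_on_gsem:
  assumes "quantum_signature Q" "wf_circ Q C" "qv C \<subseteq> W"
  shows "linear_on (assigns Q W) (gsem Q W C)"
  using assms(2,3)
proof (induction C)
  case Skip
  then show ?case by (auto simp: linear_on_def gsem_Skip l2_add l2_scale)
next
  case (Gate u qs)
  then show ?case
    unfolding gsem_def qv.simps sem.simps
    by (intro linear_on_extend gate_op_linear_bounded[OF assms(1)])
next
  case (Seq C D)
  then have "linear_on (assigns Q W) (gsem Q W D \<circ> gsem Q W C)"
    by (intro linear_on_comp) auto
  moreover have "gsem Q W (Seq C D) = gsem Q W D \<circ> gsem Q W C"
    using Seq.prems by (auto simp: gsem_Seq)
  ultimately show ?case by (simp only:)
next
  case (QIf qs bs)
  have "linear_on (assigns Q W)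
      (\<lambda>v \<sigma>. \<Sum>b\<leftarrow>bs. (extend Q (set qs) W (ketbra (assigns Q (set qs)) (fst b) (fst b))
        \<circ> gsem Q W (snd b)) v \<sigma>)"
  proof (intro linear_on_sum_list linear_on_comp linear_on_ketbra_extend)
    fix b assume b: "b \<in> set bs"
    show "linear_on (assigns Q W) (gsem Q W (snd b))"
    proof (rule QIf.IH[OF b])
      show "snd b \<in> Basic_BNFs.snds b" by (cases b) simp
      show "wf_circ Q (snd b)" using QIf.prems(1) b by auto
      have "qv (snd b) \<subseteq> qv (QIf qs bs)" using b by force
      then show "qv (snd b) \<subseteq> W" using QIf.prems(2) by (rule order_trans)
    qed
  qed (use QIf.prems(2) guard_finite[OF QIf.prems(1)] guard_in_l2[OF QIf.prems(1)] in auto)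
  moreover have "gsem Q W (QIf qs bs) = (\<lambda>v \<sigma>. \<Sum>b\<leftarrow>bs. (extend Q (set qs) W
      (ketbra (assigns Q (set qs)) (fst b) (fst b)) \<circ> gsem Q W (snd b)) v \<sigma>)"
    by (intro ext) (simp add: gsem_QIf[OF QIf.prems(2)] case_prod_unfold)
  ultimately show ?case by (simp only:)
qed

lemma gsem_l2:
  assumes "quantum_signature Q" "wf_circ Q C" "qv C \<subseteq> W" "v \<in> l2 (assigns Q W)"
  shows "gsem Q W C v \<in> l2 (assigns Q W)"
  using linear_onD(1)[OF linear_on_gsem] assms by blast

text \<open>The value at \<open>\<sigma>\<close> is computed from a single slice, in which only the
  variables of \<open>C\<close> vary. A case distinction on the label of a register disjoint from
  \<open>qv C\<close> can therefore be resolved inside the argument of \<open>gsem\<close>.\<close>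

lemma gsem_local:
  assumes "qv C \<subseteq> W" "\<sigma> \<in> assigns Q W"
    and "\<And>\<tau>. \<tau> \<in> assigns Q W \<Longrightarrow> (\<And>q. q \<notin> qv C \<Longrightarrow> \<tau> q = \<sigma> q) \<Longrightarrow> u \<tau> = v \<tau>"
  shows "gsem Q W C u \<sigma> = gsem Q W C v \<sigma>"
proof -
  have "slice Q (qv C) u \<sigma> = slice Q (qv C) v \<sigma>"
    unfolding slice_def
    by (intro ext if_cong refl assms(3) assigns_overlay[OF _ assms(2,1)]) (simp_all add: overlay_def)
  then show ?thesis by (simp add: gsem_def extend_eq)
qed

lemma extend_ketbra:
  assumes "\<sigma> \<in> assigns Q W"
  shows "extend Q S W (ketbra (assigns Q S) \<phi> \<psi>) v \<sigma> =
    \<phi> (restrict \<sigma> S) * l2_inner (assigns Q S) \<psi> (slice Q S v \<sigma>)"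
  using assms by (simp add: extend_eq ketbra_def)

lemma extend_ketbra_finite:
  assumes "\<sigma> \<in> assigns Q W" "finite (assigns Q S)"
  shows "extend Q S W (ketbra (assigns Q S) \<phi> \<psi>) v \<sigma> =
    (\<Sum>\<rho>\<in>assigns Q S. \<phi> (restrict \<sigma> S) * cnj (\<psi> \<rho>) * v (overlay S \<rho> \<sigma>))"
  using assms by (simp add: extend_ketbra l2_inner_def slice_def sum_distrib_left mult.assoc)

text \<open>The operator \<open>|e\<rangle>\<langle>e| \<otimes> I\<close> merely erases the labels
  whose guard part differs from \<open>e\<close>, so one summand survives at
  \<open>\<sigma>\<close>.\<close>

lemma gsem_QIf_std:
  assumes "qv (QIf qs bs) \<subseteq> W" "\<sigma> \<in> assigns Q W"
    and "std_enum Q qs es" "bs = map (\<lambda>e. (ket e, F e)) es"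
  shows "gsem Q W (QIf qs bs) v \<sigma> = gsem Q W (F (restrict \<sigma> (set qs))) v \<sigma>"
proof -
  let ?S = "set qs"
  have S: "?S \<subseteq> W" using assms(1) by simp
  have es: "distinct es" "set es = assigns Q ?S" using assms(3) by (auto simp: std_enum_def)
  have fin: "finite (assigns Q ?S)" unfolding es(2)[symmetric] by simp
  have "gsem Q W (QIf qs bs) v \<sigma> =
      (\<Sum>e\<leftarrow>es. extend Q ?S W (ketbra (assigns Q ?S) (ket e) (ket e)) (gsem Q W (F e) v) \<sigma>)"
    by (simp add: gsem_QIf[OF assms(1)] del: qv.simps) (simp add: assms(4) o_def)
  also have "\<dots> = (\<Sum>e\<in>assigns Q ?S. extend Q ?S W (ketbra (assigns Q ?S) (ket e) (ket e)) (gsem Q W (F e) v) \<sigma>)"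
    using es by (simp add: sum_list_distinct_conv_sum_set)
  also have "\<dots> = (\<Sum>e\<in>assigns Q ?S. if e = restrict \<sigma> ?S then gsem Q W (F e) v \<sigma> else 0)"
    using assms(2) S by (intro sum.cong) (auto simp: extend_ketbra l2_inner_ket slice_restrict ket_apply)
  also have "\<dots> = gsem Q W (F (restrict \<sigma> ?S)) v \<sigma>"
    using fin assigns_restrict[OF assms(2) S] by simp
  finally show ?thesis .
qed

text \<open>By disjointness, the rank-one operator only combines slices of \<open>v\<close> taken at
  different labels of \<open>S\<close>, with coefficients that \<open>C\<close> cannot change;
  linearity moves \<open>C\<close> inside this finite combination.\<close>

lemma gsem_ketbra_commute:
  assumes "quantum_signature Q" "wf_circ Q C" "qv C \<subseteq> W" "S \<subseteq> W" "S \<inter> qv C = {}"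
    and "finite (assigns Q S)" "v \<in> l2 (assigns Q W)"
  shows "gsem Q W C (extend Q S W (ketbra (assigns Q S) \<phi> \<psi>) v) =
    extend Q S W (ketbra (assigns Q S) \<phi> \<psi>) (gsem Q W C v)"
proof
  fix \<sigma>
  let ?T = "qv C" and ?K = "extend Q S W (ketbra (assigns Q S) \<phi> \<psi>)"
  define A where "A = gsem Q ?T C"
  have gsem: "gsem Q W C = extend Q ?T W A"
    unfolding A_def using assms(3) by (intro gsem_extend) auto
  have lin: "linear_on (assigns Q ?T) A"
    unfolding A_def using assms by (intro linear_on_gsem) auto
  show "gsem Q W C (?K v) \<sigma> = ?K (gsem Q W C v) \<sigma>"
  proof (cases "\<sigma> \<in> assigns Q W")
    case True
    define c where "c = (\<lambda>\<rho>. \<phi> (restrict \<sigma> S) * cnj (\<psi> \<rho>))"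
    have ov: "overlay S \<rho> \<sigma> \<in> assigns Q W" if "\<rho> \<in> assigns Q S" for \<rho>
      by (rule assigns_overlay[OF that True assms(4)])
    have "slice Q ?T (?K v) \<sigma> = (\<lambda>\<tau>. \<Sum>\<rho>\<in>assigns Q S. c \<rho> * slice Q ?T v (overlay S \<rho> \<sigma>) \<tau>)"
    proof
      fix \<tau>
      show "slice Q ?T (?K v) \<sigma> \<tau> = (\<Sum>\<rho>\<in>assigns Q S. c \<rho> * slice Q ?T v (overlay S \<rho> \<sigma>) \<tau>)"
      proof (cases "\<tau> \<in> assigns Q ?T")
        case \<tau>: True
        have "restrict (overlay ?T \<tau> \<sigma>) S = restrict \<sigma> S"
          using assms(5) by (intro restrict_overlay_disjoint) auto
        then show ?thesis
          using \<tau> True assms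
          by (simp add: slice_def[of Q ?T] extend_ketbra_finite assigns_overlay c_def
              overlay_commute[OF assms(5)])
      qed (simp add: slice_def)
    qed
    moreover have "slice Q ?T v (overlay S \<rho> \<sigma>) \<in> l2 (assigns Q ?T)" if "\<rho> \<in> assigns Q S" for \<rho>
      using assms(7,3) ov[OF that] by (rule slice_l2)
    ultimately have "A (slice Q ?T (?K v) \<sigma>) =
        (\<lambda>\<tau>. \<Sum>\<rho>\<in>assigns Q S. c \<rho> * A (slice Q ?T v (overlay S \<rho> \<sigma>)) \<tau>)"
      by (simp add: linear_on_sum[OF lin])
    then show ?thesis
      using True ov assms(6) 
      by (simp add: gsem extend_eq[of Q ?T] extend_ketbra_finite c_def restrict_overlay_disjoint[OF assms(5)])
  qed (simp add: gsem_outside extend_outside)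
qed

section \<open>Normal forms\<close>

definition std_qif ::
  "'q list \<Rightarrow> ('q \<Rightarrow> 'b) list \<Rightarrow> (('q \<Rightarrow> 'b) \<Rightarrow> ('q, 'b, 'u) circ) \<Rightarrow> ('q, 'b, 'u) circ" where
  "std_qif qs es F = QIf qs (map (\<lambda>e. (ket e, F e)) es)"

lemma qv_std_qif: "qv (std_qif qs es F) = set qs \<union> (\<Union>e\<in>set es. qv (F e))"
  by (auto simp: std_qif_def)

lemma guards_std_qif: "guards (std_qif qs es F) = insert qs (\<Union>e\<in>set es. guards (F e))"
  by (auto simp: std_qif_def)

lemma guards_gate_seq: "gate_seq G \<Longrightarrow> guards G = {}"
  by (induction G) auto

lemma wf_std_qif:
  assumes "is_register Q qs" "std_enum Q qs es"
    and "\<And>e. e \<in> set es \<Longrightarrow> wf_circ Q (F e) \<and> set qs \<inter> qv (F e) = {}"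
  shows "wf_circ Q (std_qif qs es F)"
  using assms orthonormal_basis_kets[of es "assigns Q (set qs)"]
  by (auto simp: std_qif_def std_enum_def o_def)

lemma normal_form_std_qif:
  assumes "std_enum Q qs es" "\<And>e. e \<in> set es \<Longrightarrow> gate_seq (F e)"
  shows "normal_form Q (std_qif qs es F)"
  using assms by (auto simp: std_qif_def o_def)

text \<open>Labels can replace list positions as the index of the branches, which turns branch
  selection into function application.\<close>

lemma tabulate:
  assumes "distinct es" "length bs = length es"
  obtains g where "bs = map g es"
proof
  show "bs = map (the \<circ> map_of (zip es bs)) es"
    using assms by (intro nth_equalityI) (auto simp: map_of_zip_nth)
qed

lemma flat_qif_cases:
  assumes "flat_qif Q N"
  obtains qs es F where "N = std_qif qs es F" "std_enum Q qs es" "\<forall>e\<in>set es. gate_seq (F e)"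
proof -
  obtain qs bs es where N: "N = QIf qs bs" and es: "std_enum Q qs es" "map fst bs = map ket es"
    and G: "\<forall>(\<psi>, G)\<in>set bs. gate_seq G"
    using assms by (cases N) auto
  have "distinct es" "length bs = length es"
    using es map_eq_imp_length_eq by (auto simp: std_enum_def)
  then obtain g where g: "bs = map g es" by (rule tabulate)
  then have "\<forall>e\<in>set es. fst (g e) = ket e" using es by simp
  then have "bs = map (\<lambda>e. (ket e, snd (g e))) es"
    unfolding g by (auto simp: prod_eq_iff)
  then have "N = std_qif qs es (\<lambda>e. snd (g e))" by (simp add: N std_qif_def)
  moreover have "gate_seq (snd (g e))" if "e \<in> set es" for e
    using G that by (auto simp: g case_prod_unfold)
  ultimately show ?thesis using es that by blast
qed

lemma std_enum_exists:
  assumes "finite (assigns Q (set qs))"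
  obtains es where "std_enum Q qs es"
  using finite_distinct_list[OF assms] by (auto simp: std_enum_def)

lemma std_enum_finite: "std_enum Q qs es \<Longrightarrow> finite (assigns Q (set qs))"
  by (metis List.finite_set std_enum_def)

lemma gsem_std_qif:
  assumes "std_enum Q qs es" "qv (std_qif qs es F) \<subseteq> W" "\<sigma> \<in> assigns Q W"
  shows "gsem Q W (std_qif qs es F) v \<sigma> = gsem Q W (F (restrict \<sigma> (set qs))) v \<sigma>"
  unfolding std_qif_def using assms(2)[unfolded std_qif_def] assms(3,1) refl by (rule gsem_QIf_std)

text \<open>The equation is required on every \<open>W\<close> containing \<open>V\<close>, since a
  piece built for few variables is later used inside a larger circuit. \<open>V\<close> keeps
  disjointness from further guards checkable, and \<open>b\<close> switches on the demand for
  nonempty guard registers.\<close>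

definition realizes ::
  "('q, 'b, 'u) qsig \<Rightarrow> bool \<Rightarrow> 'q set \<Rightarrow> ('q, 'b, 'u) circ \<Rightarrow>
   ('q set \<Rightarrow> ('q \<Rightarrow> 'b) oper) \<Rightarrow> bool" where
  "realizes Q b V N A \<longleftrightarrow>
     wf_circ Q N \<and> normal_form Q N \<and> qv N \<subseteq> V \<and> (b \<longrightarrow> [] \<notin> guards N) \<and>
     (\<forall>W. V \<subseteq> W \<longrightarrow> (\<forall>v\<in>l2 (assigns Q W). gsem Q W N v = A W v))"

lemma realizesD:
  assumes "realizes Q b V N A"
  shows "wf_circ Q N" "normal_form Q N" "qv N \<subseteq> V" "b \<Longrightarrow> [] \<notin> guards N"
    and "V \<subseteq> W \<Longrightarrow> v \<in> l2 (assigns Q W) \<Longrightarrow> gsem Q W N v = A W v"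
  using assms by (auto simp: realizes_def)

lemma realizes_mono: "realizes Q b V N A \<Longrightarrow> V \<subseteq> V' \<Longrightarrow> realizes Q b V' N A"
  by (auto simp: realizes_def)

lemma realizes_cong:
  assumes "realizes Q b V N A"
    and "\<And>W v. V \<subseteq> W \<Longrightarrow> v \<in> l2 (assigns Q W) \<Longrightarrow> A W v = B W v"
  shows "realizes Q b V N B"
  using assms by (auto simp: realizes_def)

lemma realizes_Seq:
  assumes "quantum_signature Q" "realizes Q b V N A" "realizes Q b V M B"
  shows "realizes Q b V (Seq N M) (\<lambda>W v. B W (A W v))"
proof -
  have "gsem Q W (Seq N M) v = B W (A W v)" if W: "V \<subseteq> W" and v: "v \<in> l2 (assigns Q W)" for W v
  proof -
    have "gsem Q W N v \<in> l2 (assigns Q W)"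
      using assms(1) realizesD(1,3)[OF assms(2)] W v by (intro gsem_l2) auto
    moreover have "gsem Q W (Seq N M) v = gsem Q W M (gsem Q W N v)"
      using realizesD(3)[OF assms(2)] realizesD(3)[OF assms(3)] W by (intro gsem_Seq) auto
    ultimately show ?thesis
      using realizesD(5)[OF assms(2) W v] realizesD(5)[OF assms(3) W] by simp
  qed
  then show ?thesis using assms(2,3) by (auto simp: realizes_def)
qed

lemma realizes_gate_seq:
  assumes "is_register Q X" "std_enum Q X xs" "b \<longrightarrow> X \<noteq> []"
    and "wf_circ Q G" "gate_seq G" "set X \<inter> qv G = {}"
  shows "realizes Q b (set X \<union> qv G) (std_qif X xs (\<lambda>_. G)) (\<lambda>W. gsem Q W G)"
proof -
  let ?N = "std_qif X xs (\<lambda>_. G)"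
  have qv: "qv ?N \<subseteq> set X \<union> qv G" by (auto simp: qv_std_qif)
  have "gsem Q W ?N v = gsem Q W G v" if "set X \<union> qv G \<subseteq> W" for W v
  proof
    fix \<sigma>
    show "gsem Q W ?N v \<sigma> = gsem Q W G v \<sigma>"
    proof (cases "\<sigma> \<in> assigns Q W")
      case True
      with qv that show ?thesis by (intro gsem_std_qif[OF assms(2)]) auto
    qed (simp add: gsem_outside)
  qed
  moreover have "b \<Longrightarrow> [] \<notin> guards ?N"
    using assms(3,5) by (auto simp: guards_std_qif guards_gate_seq)
  moreover have "wf_circ Q ?N" using assms by (intro wf_std_qif) auto
  moreover have "normal_form Q ?N" using assms by (intro normal_form_std_qif) auto
  ultimately show ?thesis using qv by (auto simp: realizes_def)
qed

text \<open>
  Conditioning a normal form on the basis state \<open>e\<close> of a disjoint register \<open>qs\<close> only enlarges its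
  guard registers by \<open>qs\<close>, with \<^term>\<open>Skip\<close> in all branches that do not extend \<open>e\<close>.
\<close>

definition controlled ::
  "('q, 'b, 'u) qsig \<Rightarrow> 'q set \<Rightarrow> ('q \<Rightarrow> 'b) \<Rightarrow> ('q, 'b, 'u) circ \<Rightarrow> 'q set \<Rightarrow> ('q \<Rightarrow> 'b) oper" where
  "controlled Q S e N W = (\<lambda>v \<sigma>. if restrict \<sigma> S = e then gsem Q W N v \<sigma> else v \<sigma>)"

lemma controlled_flat:
  assumes "wf_circ Q (std_qif rs fs F)" "std_enum Q rs fs" "\<And>f. f \<in> set fs \<Longrightarrow> gate_seq (F f)"
    and "is_register Q qs" "finite (assigns Q (set qs))" "set qs \<inter> qv (std_qif rs fs F) = {}"
    and "b \<Longrightarrow> rs \<noteq> []"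
  shows "\<exists>N'. realizes Q b (set qs \<union> qv (std_qif rs fs F)) N' (controlled Q (set qs) e (std_qif rs fs F))"
proof -
  let ?N = "std_qif rs fs F" and ?ps = "qs @ rs"
  have fs: "set fs = assigns Q (set rs)" using assms(2) by (simp add: std_enum_def)
  have "finite (assigns Q (set ?ps))"
    using finite_assigns_Un[OF assms(5) std_enum_finite[OF assms(2)]] by simp
  then obtain es where es: "std_enum Q ?ps es" by (rule std_enum_exists)
  define F' where "F' = (\<lambda>\<rho>. if restrict \<rho> (set qs) = e then F (restrict \<rho> (set rs)) else Skip)"
  let ?N' = "std_qif ?ps es F'"
  have res: "restrict \<rho> (set rs) \<in> set fs" if "\<rho> \<in> set es" for \<rho>
    using that es unfolding fs by (auto simp: std_enum_def intro: assigns_restrict)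
  have F: "wf_circ Q (F f)" "set rs \<inter> qv (F f) = {}" "set qs \<inter> qv (F f) = {}" if "f \<in> set fs" for f
    using assms(1,6) that by (auto simp: std_qif_def)
  have reg: "is_register Q ?ps"
    using assms(1,4,6) by (auto simp: std_qif_def is_register_def)
  have "wf_circ Q (F' \<rho>) \<and> set ?ps \<inter> qv (F' \<rho>) = {}" if "\<rho> \<in> set es" for \<rho>
    using F[OF res[OF that]] by (auto simp: F'_def)
  with reg es have "wf_circ Q ?N'" by (rule wf_std_qif)
  moreover have "normal_form Q ?N'"
    using es by (rule normal_form_std_qif) (auto simp: F'_def assms(3) res)
  moreover have qv: "qv ?N' \<subseteq> set qs \<union> qv ?N"
    using res by (auto simp: qv_std_qif F'_def split: if_splits)
  moreover have "[] \<notin> guards ?N'" if b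
  proof -
    have "guards (F' \<rho>) = {}" if "\<rho> \<in> set es" for \<rho>
      using that by (simp add: F'_def guards_gate_seq assms(3) res)
    then show ?thesis using assms(7)[OF that] by (auto simp: guards_std_qif)
  qed
  moreover have "gsem Q W ?N' v = controlled Q (set qs) e ?N W v"
    if W: "set qs \<union> qv ?N \<subseteq> W" and v: "v \<in> l2 (assigns Q W)" for W v
  proof
    fix \<sigma>
    show "gsem Q W ?N' v \<sigma> = controlled Q (set qs) e ?N W v \<sigma>"
    proof (cases "\<sigma> \<in> assigns Q W")
      case True
      have "gsem Q W ?N' v \<sigma> = gsem Q W (F' (restrict \<sigma> (set ?ps))) v \<sigma>"
        using qv W True by (intro gsem_std_qif[OF es]) auto
      moreover have "gsem Q W ?N v \<sigma> = gsem Q W (F (restrict \<sigma> (set rs))) v \<sigma>"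
        using W True by (intro gsem_std_qif[OF assms(2)]) auto
      ultimately show ?thesis
        using v by (simp add: controlled_def F'_def gsem_Skip Int_absorb1 Un_Int_eq)
    next
      case False
      then show ?thesis using v by (simp add: controlled_def gsem_outside l2_outside)
    qed
  qed
  ultimately show ?thesis by (auto simp: realizes_def)
qed

lemma controlled_normal_form:
  assumes "quantum_signature Q" "is_register Q qs" "finite (assigns Q (set qs))"
    and "wf_circ Q N" "normal_form Q N" "set qs \<inter> qv N = {}" "b \<Longrightarrow> [] \<notin> guards N"
  shows "\<exists>N'. realizes Q b (set qs \<union> qv N) N' (controlled Q (set qs) e N)"
  using assms(4-)
proof (induction N)
  case (Seq N M)
  let ?V = "set qs \<union> qv (Seq N M)"
  obtain N' where "realizes Q b (set qs \<union> qv N) N' (controlled Q (set qs) e N)"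
    using Seq by auto
  then have N': "realizes Q b ?V N' (controlled Q (set qs) e N)" by (rule realizes_mono) auto
  obtain M' where "realizes Q b (set qs \<union> qv M) M' (controlled Q (set qs) e M)"
    using Seq by auto
  then have M': "realizes Q b ?V M' (controlled Q (set qs) e M)" by (rule realizes_mono) auto
  have "realizes Q b ?V (Seq N' M') (controlled Q (set qs) e (Seq N M))"
  proof (rule realizes_cong[OF realizes_Seq[OF assms(1) N' M']])
    fix W and v :: "('a \<Rightarrow> 'b) vect" assume W: "?V \<subseteq> W" and v: "v \<in> l2 (assigns Q W)"
    show "controlled Q (set qs) e M W (controlled Q (set qs) e N W v) = controlled Q (set qs) e (Seq N M) W v"
    proof
      fix \<sigma>
      \<comment> \<open>\<open>M\<close> leaves \<open>qs\<close> alone, so at a label with guard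
        part \<open>e\<close> it reads only labels with the same guard part, where the conditioned
        \<open>N\<close> agrees with \<open>N\<close>.\<close>
      have "gsem Q W M (controlled Q (set qs) e N W v) \<sigma> = gsem Q W M (gsem Q W N v) \<sigma>"
        if "restrict \<sigma> (set qs) = e"
      proof (cases "\<sigma> \<in> assigns Q W")
        case True
        show ?thesis
        proof (rule gsem_local[OF _ True])
          fix \<tau> assume "\<And>q. q \<notin> qv M \<Longrightarrow> \<tau> q = \<sigma> q"
          then have "restrict \<tau> (set qs) = restrict \<sigma> (set qs)"
            using Seq.prems(3) by (intro restrict_ext) auto
          then show "controlled Q (set qs) e N W v \<tau> = gsem Q W N v \<tau>"
            using that by (simp add: controlled_def)
        qed (use W in auto)
      qed (simp add: gsem_outside)
      then show "controlled Q (set qs) e M W (controlled Q (set qs) e N W v) \<sigma> =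
          controlled Q (set qs) e (Seq N M) W v \<sigma>"
        using gsem_Seq[of N M W Q v] W by (auto simp: controlled_def)
    qed
  qed
  then show ?case by blast
next
  case (QIf rs bs)
  then have "flat_qif Q (QIf rs bs)" by simp
  then obtain rs' fs F where F: "QIf rs bs = std_qif rs' fs F" "std_enum Q rs' fs"
    "\<forall>f\<in>set fs. gate_seq (F f)"
    by (rule flat_qif_cases)
  have "rs' \<noteq> []" if b
    using QIf.prems(4)[OF that] unfolding F(1) by (auto simp: guards_std_qif)
  then show ?case
    using QIf.prems F(2,3) assms(2,3) unfolding F(1) by (intro controlled_flat) auto
qed auto

text \<open>Guard labels are served one at a time, and those not yet in \<open>es\<close> still see
  the identity. \<open>I\<close> is supplied as base case because \<open>Skip\<close> by itself is
  not a normal form.\<close>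

lemma select_normal_form:
  assumes "quantum_signature Q" "is_register Q qs" "finite (assigns Q (set qs))"
    and I: "realizes Q b V I (\<lambda>W v. v)"
    and "set qs \<subseteq> V" "distinct es"
    and N: "\<And>e. e \<in> set es \<Longrightarrow> realizes Q b V (N e) (\<lambda>W. gsem Q W (C e)) \<and> set qs \<inter> qv (N e) = {}"
  shows "\<exists>M. realizes Q b V M
    (\<lambda>W v \<sigma>. if restrict \<sigma> (set qs) \<in> set es then gsem Q W (C (restrict \<sigma> (set qs))) v \<sigma> else v \<sigma>)"
  using assms(6) N
proof (induction es)
  case Nil
  then show ?case using I by auto
next
  case (Cons e es)
  let ?A = "\<lambda>es W v \<sigma>. if restrict \<sigma> (set qs) \<in> set es then gsem Q W (C (restrict \<sigma> (set qs))) v \<sigma> else v \<sigma>"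
  have "\<exists>M. realizes Q b V M (?A es)" by (rule Cons.IH) (use Cons.prems in auto)
  then obtain M where M: "realizes Q b V M (?A es)" ..
  have e: "realizes Q b V (N e) (\<lambda>W. gsem Q W (C e))" "set qs \<inter> qv (N e) = {}"
    using Cons.prems(2)[of e] by auto
  obtain K where "realizes Q b (set qs \<union> qv (N e)) K (controlled Q (set qs) e (N e))"
    using controlled_normal_form[OF assms(1-3) realizesD(1,2)[OF e(1)] e(2) realizesD(4)[OF e(1)]] by blast
  then have K: "realizes Q b V K (controlled Q (set qs) e (N e))"
    by (rule realizes_mono) (use assms(5) realizesD(3)[OF e(1)] in auto)
  have "realizes Q b V (Seq M K) (?A (e # es))"
  proof (rule realizes_cong[OF realizes_Seq[OF assms(1) M K]])
    fix W and v :: "('a \<Rightarrow> 'b) vect" assume W: "V \<subseteq> W" and v: "v \<in> l2 (assigns Q W)"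
    show "controlled Q (set qs) e (N e) W (?A es W v) = ?A (e # es) W v"
    proof
      fix \<sigma>
      \<comment> \<open>By distinctness \<open>e\<close> has not been served yet, and all labels
        that \<open>N e\<close> reads here have guard part \<open>e\<close>, so \<open>M\<close>
        acts on them as the identity.\<close>
      have "gsem Q W (N e) (?A es W v) \<sigma> = gsem Q W (C e) v \<sigma>" if \<sigma>: "restrict \<sigma> (set qs) = e"
      proof -
        have "gsem Q W (N e) (?A es W v) \<sigma> = gsem Q W (N e) v \<sigma>"
        proof (cases "\<sigma> \<in> assigns Q W")
          case True
          show ?thesis
          proof (rule gsem_local[OF _ True])
            fix \<tau> assume "\<And>q. q \<notin> qv (N e) \<Longrightarrow> \<tau> q = \<sigma> q"
            then have "restrict \<tau> (set qs) = restrict \<sigma> (set qs)"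
              using e(2) by (intro restrict_ext) auto
            then show "?A es W v \<tau> = v \<tau>" using \<sigma> Cons.prems(1) by simp
          qed (use W realizesD(3)[OF e(1)] in auto)
        qed (simp add: gsem_outside)
        then show ?thesis using realizesD(5)[OF e(1) W v] by simp
      qed
      then show "controlled Q (set qs) e (N e) W (?A es W v) \<sigma> = ?A (e # es) W v \<sigma>"
        by (auto simp: controlled_def)
    qed
  qed
  then show ?case by blast
qed

text \<open>Implementability concerns the register alone; it passes to every larger \<open>W\<close>
  because the slices of an \<open>l2\<close> vector are \<open>l2\<close> vectors of the
  register.\<close>

lemma implementable_gsem:
  assumes "implementable Q qs A"
  obtains G where "wf_circ Q G" "gate_seq G" "qv G \<subseteq> set qs"
    "\<forall>W v \<sigma>. set qs \<subseteq> W \<longrightarrow> v \<in> l2 (assigns Q W) \<longrightarrow>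
      gsem Q W G v \<sigma> = extend Q (set qs) W A v \<sigma>"
proof -
  obtain G where G: "wf_circ Q G" "gate_seq G" "qv G \<subseteq> set qs"
    and A: "\<And>v. v \<in> l2 (assigns Q (set qs)) \<Longrightarrow> gsem Q (set qs) G v = A v"
    using assms by (auto simp: implementable_def QC_def gsem_def)
  have "gsem Q W G v \<sigma> = extend Q (set qs) W A v \<sigma>"
    if "set qs \<subseteq> W" "v \<in> l2 (assigns Q W)" for W v \<sigma>
    using that G(3) by (simp add: gsem_extend[of G "set qs" W] extend_eq A slice_l2)
  with G show ?thesis by (blast intro: that)
qed

text \<open>
  The change of basis: for \<open>\<Sum>\<^sub>e |\<psi>\<^sub>e\<rangle>\<langle>\<psi>\<^sub>e| \<otimes> \<lbrakk>C\<^sub>e\<rbrakk>\<close> one first applies \<open>\<Sum>\<^sub>e |e\<rangle>\<langle>\<psi>\<^sub>e|\<close>, which commutes with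
  every \<open>\<lbrakk>C\<^sub>e\<rbrakk>\<close>, then \<open>\<lbrakk>C\<^sub>e\<rbrakk>\<close> controlled by the standard basis, and finally \<open>\<Sum>\<^sub>e |\<psi>\<^sub>e\<rangle>\<langle>e|\<close>.
\<close>

lemma gsem_QIf_change_of_basis:
  fixes bs es g qs S
  defines "S \<equiv> set qs"
  assumes "quantum_signature Q" "wf_circ Q (QIf qs (map g es))" "std_enum Q qs es"
    and W: "qv (QIf qs (map g es)) \<subseteq> W" and v: "v \<in> l2 (assigns Q W)" and \<sigma>: "\<sigma> \<in> assigns Q W"
    and u: "\<And>\<tau>. \<tau> \<in> assigns Q W \<Longrightarrow> u \<tau> =
      (\<Sum>e\<in>assigns Q S. extend Q S W (ketbra (assigns Q S) (ket e) (fst (g e))) v \<tau>)"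
    and u': "\<And>\<tau>. \<tau> \<in> assigns Q W \<Longrightarrow> u' \<tau> = gsem Q W (snd (g (restrict \<tau> S))) u \<tau>"
  shows "gsem Q W (QIf qs (map g es)) v \<sigma> =
    (\<Sum>e\<in>assigns Q S. extend Q S W (ketbra (assigns Q S) (fst (g e)) (ket e)) u' \<sigma>)"
proof -
  let ?K = "\<lambda>\<phi> \<psi>. extend Q S W (ketbra (assigns Q S) \<phi> \<psi>)"
  have es: "distinct es" "set es = assigns Q S"
    using assms(4) by (auto simp: std_enum_def S_def)
  have fin: "finite (assigns Q S)" using es(2) by (metis List.finite_set)
  have SW: "S \<subseteq> W" using W by (auto simp: S_def)
  have "gsem Q W (QIf qs (map g es)) v \<sigma> =
      (\<Sum>e\<in>assigns Q S. ?K (fst (g e)) (fst (g e)) (gsem Q W (snd (g e)) v) \<sigma>)"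
    unfolding gsem_QIf[OF W] using es
    by (simp add: case_prod_unfold o_def S_def sum_list_distinct_conv_sum_set)
  also have "\<dots> = (\<Sum>e\<in>assigns Q S. ?K (fst (g e)) (ket e) u' \<sigma>)"
  proof (rule sum.cong[OF refl])
    fix e assume e: "e \<in> assigns Q S"
    \<comment> \<open>The operator \<open>|\<psi>\<rangle>\<langle>e|\<close> reads its argument at
      the label whose guard part is replaced by \<open>e\<close>, so only the value of
      \<open>u'\<close> at \<open>?\<sigma>\<close> matters.\<close>
    let ?C = "snd (g e)" and ?\<sigma> = "overlay S e \<sigma>"
    have "e \<in> set es" using e es by simp
    then have C: "wf_circ Q ?C" "S \<inter> qv ?C = {}" "qv ?C \<subseteq> W"
      using assms(3) W by (auto simp: S_def case_prod_unfold)
    have ov: "?\<sigma> \<in> assigns Q W" "restrict ?\<sigma> S = e"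
      using assigns_overlay[OF e \<sigma> SW] restrict_overlay[OF e] by auto
    have "u' ?\<sigma> = gsem Q W ?C u ?\<sigma>" using u'[OF ov(1)] ov(2) by simp
    also have "\<dots> = gsem Q W ?C (?K (ket e) (fst (g e)) v) ?\<sigma>"
    proof (rule gsem_local[OF C(3) ov(1)])
      fix \<tau> assume \<tau>: "\<tau> \<in> assigns Q W" and "\<And>q. q \<notin> qv ?C \<Longrightarrow> \<tau> q = ?\<sigma> q"
      then have "restrict \<tau> S = restrict ?\<sigma> S"
        using C(2) by (intro restrict_ext) auto
      then have "restrict \<tau> S = e" using ov(2) by simp
      then have "u \<tau> = (\<Sum>d\<in>assigns Q S. if d = e then ?K (ket e) (fst (g e)) v \<tau> else 0)"
        unfolding u[OF \<tau>] using \<tau> by (intro sum.cong) (auto simp: extend_ketbra ket_apply)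
      then show "u \<tau> = ?K (ket e) (fst (g e)) v \<tau>" using fin e by simp
    qed
    also have "\<dots> = ?K (ket e) (fst (g e)) (gsem Q W ?C v) ?\<sigma>"
      using assms(2) C SW fin v by (simp add: gsem_ketbra_commute)
    also have "\<dots> = l2_inner (assigns Q S) (fst (g e)) (slice Q S (gsem Q W ?C v) \<sigma>)"
      using ov by (simp add: extend_ketbra ket_apply slice_overlay)
    finally show "?K (fst (g e)) (fst (g e)) (gsem Q W ?C v) \<sigma> = ?K (fst (g e)) (ket e) u' \<sigma>"
      using \<sigma> e by (simp add: extend_ketbra l2_inner_ket) (simp add: slice_def)
  qed
  finally show ?thesis .
qed

text \<open>One \<open>X\<close> serves all gates at all nesting levels and stays fixed in the
  induction. The conclusion \<open>set X \<subseteq> qv N\<close> makes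
  \<open>qv C \<union> qv N\<close>, the ambient register of \<open>equivalent\<close>, large enough
  for the equation in \<open>realizes\<close>.\<close>

lemma normal_form_exists:
  assumes Q: "quantum_signature Q" and X: "is_register Q X" "std_enum Q X xs" "b \<longrightarrow> X \<noteq> []"
    and "wf_circ Q C" "regular Q C" "set X \<inter> qv C = {}"
  shows "\<exists>N. realizes Q b (set X \<union> qv C) N (\<lambda>W. gsem Q W C) \<and> set X \<subseteq> qv N"
proof -
  have atom: "\<exists>N. realizes Q b (set X \<union> qv G) N (\<lambda>W. gsem Q W G) \<and> set X \<subseteq> qv N"
    if "wf_circ Q G" "gate_seq G" "set X \<inter> qv G = {}" for G
    using realizes_gate_seq[OF X that] by (intro exI conjI) (auto simp: qv_std_qif)
  show ?thesis
    using assms(5-7)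
  proof (induction C)
    case Skip
    then show ?case by (intro atom) simp_all
  next
    case (Gate u qs)
    then show ?case by (intro atom) simp_all
  next
    case (Seq C D)
    let ?V = "set X \<union> qv (Seq C D)"
    obtain N where N0: "realizes Q b (set X \<union> qv C) N (\<lambda>W. gsem Q W C)" and X': "set X \<subseteq> qv N"
      using Seq by auto
    have N: "realizes Q b ?V N (\<lambda>W. gsem Q W C)" by (rule realizes_mono[OF N0]) auto
    obtain M where "realizes Q b (set X \<union> qv D) M (\<lambda>W. gsem Q W D)" using Seq by auto
    then have M: "realizes Q b ?V M (\<lambda>W. gsem Q W D)" by (rule realizes_mono) auto
    have "realizes Q b ?V (Seq N M) (\<lambda>W. gsem Q W (Seq C D))"
      by (rule realizes_cong[OF realizes_Seq[OF Q N M]]) (auto simp: gsem_Seq)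
    with X' show ?case by (intro exI[of _ "Seq N M"]) auto
  next
    case (QIf qs bs)
    let ?C = "QIf qs bs" and ?S = "set qs"
    let ?V = "set X \<union> qv ?C"
    obtain es where es: "std_enum Q qs es"
      and impl: "implementable Q qs
          (\<lambda>v \<sigma>. \<Sum>(\<psi>, e)\<leftarrow>zip (map fst bs) es. ketbra (assigns Q ?S) \<psi> (ket e) v \<sigma>)"
        "implementable Q qs
          (\<lambda>v \<sigma>. \<Sum>(\<psi>, e)\<leftarrow>zip (map fst bs) es. ketbra (assigns Q ?S) (ket e) \<psi> v \<sigma>)"
      using QIf.prems(2) by (auto simp: regular_guard_def)
    have dist: "distinct es" and set_es: "set es = assigns Q ?S"
      using es by (auto simp: std_enum_def)
    \<comment> \<open>Both are the dimension of the guard space, so the \<open>zip\<close> in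
      \<open>regular_guard\<close> drops nothing and branches can be indexed by basis
      labels.\<close>
    have "length bs = length es"
      using guard_finite(2)[OF QIf.prems(1)] distinct_card[OF dist] by (simp add: set_es)
    then obtain g where g: "bs = map g es" using dist tabulate by blast
    have zip: "zip (map fst bs) es = map (\<lambda>e. (fst (g e), e)) es"
      unfolding g by (simp add: zip_map1 zip_same_conv_map)
    have extend_zip: "extend Q ?S W (\<lambda>v \<sigma>. \<Sum>(\<psi>, e)\<leftarrow>zip (map fst bs) es. B \<psi> e v \<sigma>) v \<sigma> =
        (\<Sum>e\<in>assigns Q ?S. extend Q ?S W (B (fst (g e)) e) v \<sigma>)" for B W v \<sigma>
      unfolding zip using dist
      by (simp add: o_def extend_eq sum_list_distinct_conv_sum_set set_es)
    \<comment> \<open>\<open>G1\<close> turns the standard basis back into the guard basis;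
      \<open>G2\<close> is the opposite rotation and is executed first.\<close>
    obtain G1 where G1: "wf_circ Q G1" "gate_seq G1" "qv G1 \<subseteq> ?S"
      and sem1: "\<forall>W v \<sigma>. ?S \<subseteq> W \<longrightarrow> v \<in> l2 (assigns Q W) \<longrightarrow> gsem Q W G1 v \<sigma> =
        (\<Sum>e\<in>assigns Q ?S. extend Q ?S W (ketbra (assigns Q ?S) (fst (g e)) (ket e)) v \<sigma>)"
      by (rule implementable_gsem[OF impl(1), unfolded extend_zip])
    obtain G2 where G2: "wf_circ Q G2" "gate_seq G2" "qv G2 \<subseteq> ?S"
      and sem2: "\<forall>W v \<sigma>. ?S \<subseteq> W \<longrightarrow> v \<in> l2 (assigns Q W) \<longrightarrow> gsem Q W G2 v \<sigma> =
        (\<Sum>e\<in>assigns Q ?S. extend Q ?S W (ketbra (assigns Q ?S) (ket e) (fst (g e))) v \<sigma>)"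
      by (rule implementable_gsem[OF impl(2), unfolded extend_zip])
    have XS: "set X \<inter> ?S = {}" using QIf.prems(3) by auto
    have gates: "realizes Q b ?V (std_qif X xs (\<lambda>_. G)) (\<lambda>W. gsem Q W G)"
      if "wf_circ Q G" "gate_seq G" "qv G \<subseteq> ?S" for G
      using that XS by (intro realizes_mono[OF realizes_gate_seq[OF X]]) auto
    have I: "realizes Q b ?V (std_qif X xs (\<lambda>_. Skip)) (\<lambda>W v. v)"
      by (rule realizes_cong[OF gates]) (auto simp: gsem_Skip)
    have "\<exists>N. realizes Q b ?V N (\<lambda>W. gsem Q W (snd (g e))) \<and> ?S \<inter> qv N = {}" if e: "e \<in> set es" for e
    proof -
      have ge: "g e \<in> set bs" using e by (simp add: g)
      have "wf_circ Q (snd (g e)) \<and> ?S \<inter> qv (snd (g e)) = {}" "regular Q (snd (g e))"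
        using QIf.prems(1,2) ge by (auto simp only: wf_circ.simps regular.simps case_prod_unfold)
      then have D: "wf_circ Q (snd (g e))" "regular Q (snd (g e))" "?S \<inter> qv (snd (g e)) = {}"
        by auto
      have sub: "qv (snd (g e)) \<subseteq> qv ?C" using ge by force
      have "\<exists>N. realizes Q b (set X \<union> qv (snd (g e))) N (\<lambda>W. gsem Q W (snd (g e))) \<and> set X \<subseteq> qv N"
        using D(1,2) sub QIf.prems(3) by (intro QIf.IH[OF ge]) (auto simp: snds.simps prod_eq_iff)
      then obtain N where N: "realizes Q b (set X \<union> qv (snd (g e))) N (\<lambda>W. gsem Q W (snd (g e)))"
        by blast
      have "?S \<inter> qv N = {}" using realizesD(3)[OF N] D(3) XS by auto
      moreover have "realizes Q b ?V N (\<lambda>W. gsem Q W (snd (g e)))"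
        using N by (rule realizes_mono) (use sub in auto)
      ultimately show ?thesis by blast
    qed
    then obtain Nf where Nf: "\<And>e. e \<in> set es \<Longrightarrow>
        realizes Q b ?V (Nf e) (\<lambda>W. gsem Q W (snd (g e))) \<and> ?S \<inter> qv (Nf e) = {}"
      by metis
    \<comment> \<open>For \<open>W\<close> containing the guard register the test succeeds on all of
      \<open>assigns Q W\<close>, since \<open>es\<close> lists the whole standard basis.\<close>
    let ?A = "\<lambda>W v \<sigma>. if restrict \<sigma> ?S \<in> set es then gsem Q W (snd (g (restrict \<sigma> ?S))) v \<sigma> else v \<sigma>"
    have "\<exists>M. realizes Q b ?V M ?A"
      by (rule select_normal_form[where C = "\<lambda>e. snd (g e)", OF Q _ guard_finite(1)[OF QIf.prems(1)] I _ dist])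
        (use QIf.prems(1) Nf in auto)
    then obtain M where M: "realizes Q b ?V M ?A" ..
    let ?N2 = "std_qif X xs (\<lambda>_. G2)" and ?N1 = "std_qif X xs (\<lambda>_. G1)"
    have N: "realizes Q b ?V (Seq (Seq ?N2 M) ?N1) (\<lambda>W v. gsem Q W G1 (?A W (gsem Q W G2 v)))"
      by (intro realizes_Seq[OF Q] gates G1 G2 M)
    have "realizes Q b ?V (Seq (Seq ?N2 M) ?N1) (\<lambda>W. gsem Q W ?C)"
    proof (rule realizes_cong[OF N])
      fix W and v :: "('a \<Rightarrow> 'b) vect" assume W: "?V \<subseteq> W" and v: "v \<in> l2 (assigns Q W)"
      have SW: "?S \<subseteq> W" using W by simp
      have u: "gsem Q W G2 v \<in> l2 (assigns Q W)"
        using G2 SW by (intro gsem_l2[OF Q _ _ v]) auto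
      \<comment> \<open>Square-summability of the selected vector is read off from the circuit that
        computes it rather than from the case distinction.\<close>
      have "gsem Q W M (gsem Q W G2 v) \<in> l2 (assigns Q W)"
        by (rule gsem_l2[OF Q realizesD(1)[OF M] order_trans[OF realizesD(3)[OF M] W] u])
      then have u': "?A W (gsem Q W G2 v) \<in> l2 (assigns Q W)"
        using realizesD(5)[OF M W u] by simp
      show "gsem Q W G1 (?A W (gsem Q W G2 v)) = gsem Q W ?C v"
      proof
        fix \<sigma>
        show "gsem Q W G1 (?A W (gsem Q W G2 v)) \<sigma> = gsem Q W ?C v \<sigma>"
        proof (cases "\<sigma> \<in> assigns Q W")
          case True
          have "gsem Q W (QIf qs (map g es)) v \<sigma> =
            (\<Sum>e\<in>assigns Q ?S. extend Q ?S W (ketbra (assigns Q ?S) (fst (g e)) (ket e))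
              (?A W (gsem Q W G2 v)) \<sigma>)"
          proof (rule gsem_QIf_change_of_basis[OF Q _ es _ v True])
            show "gsem Q W G2 v \<tau> = (\<Sum>e\<in>assigns Q ?S.
                extend Q ?S W (ketbra (assigns Q ?S) (ket e) (fst (g e))) v \<tau>)" for \<tau>
              using sem2 SW v by blast
            show "?A W (gsem Q W G2 v) \<tau> = gsem Q W (snd (g (restrict \<tau> ?S))) (gsem Q W G2 v) \<tau>"
              if "\<tau> \<in> assigns Q W" for \<tau>
              using assigns_restrict[OF that SW] by (simp add: set_es)
          qed (use QIf.prems(1) W in \<open>simp_all add: g\<close>)
          then show ?thesis using sem1 SW u' by (simp add: g)
        qed (simp add: gsem_outside)
      qed
    qed
    then show ?case by (intro exI[of _ "Seq (Seq ?N2 M) ?N1"]) (auto simp: qv_std_qif)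
  qed
qed

theorem theorem4p1:
  fixes Q :: "('q, 'b, 'u) qsig" and C :: "('q, 'b, 'u) circ"
  assumes "quantum_signature Q"
    and "C \<in> QC Q"
    and "regular Q C"
  shows "\<exists>N\<in>QC Q. normal_form Q N \<and> equivalent Q C N \<and>
           ((\<exists>q\<in>qvars Q - qv C. finite (labels Q q)) \<longrightarrow> [] \<notin> guards N)"
proof -
  let ?b = "\<exists>q\<in>qvars Q - qv C. finite (labels Q q)"
  \<comment> \<open>Finite dimension is needed to list the standard basis as branches. Without a
    suitable fresh variable the empty register, with its one-dimensional space and single branch,
    takes its place.\<close>
  obtain X where X: "is_register Q X" "finite (assigns Q (set X))" "?b \<longrightarrow> X \<noteq> []" "set X \<inter> qv C = {}"
  proof (cases ?b)
    case True
    then obtain q where "q \<in> qvars Q - qv C" "finite (labels Q q)" by blast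
    then have "is_register Q [q]" "finite (assigns Q (set [q]))" "set [q] \<inter> qv C = {}"
      by (auto simp: is_register_def assigns_def intro!: finite_PiE)
    then show ?thesis by (intro that[of "[q]"]) auto
  next
    case False
    then show ?thesis by (intro that[of "[]"]) (auto simp: is_register_def assigns_def)
  qed
  obtain xs where xs: "std_enum Q X xs" using X(2) by (rule std_enum_exists)
  have C: "wf_circ Q C" using assms(2) by (simp add: QC_def)
  obtain N where N: "realizes Q ?b (set X \<union> qv C) N (\<lambda>W. gsem Q W C)" "set X \<subseteq> qv N"
    using normal_form_exists[OF assms(1) X(1) xs X(3) C assms(3) X(4)] by blast
  have "equivalent Q C N"
    unfolding equivalent_def gsem_def[symmetric] using N(2)
    by (intro ballI realizesD(5)[OF N(1), symmetric]) auto
  then show ?thesis using realizesD(1,2,4)[OF N(1)] by (auto simp: QC_def)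
qed

end
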